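(* Let $f:\mathbb{R}^d\to\mathbb{R}$ be $\mu$-strongly convex and $L$-smooth and consider noisy GMM with Gaussian gradient noise, with the parameters $(\alpha,\beta,\gamma)=(\alpha_{\vartheta,\psi},\beta_{\vartheta,\psi},\gamma_{\vartheta,\psi})$, $(\vartheta,\psi)\in\mathcal{S}_0\cup\mathcal{S}_c$, and initialization $z_0=[x_0^\top,x_{-1}^\top]^\top$, as described in the context. Let $\theta>0$ satisfy $\theta<\theta_u^g$ and let $t_\zeta>0$ be a threshold. Then for every $k\ge0$ $$\mathbb{P}\{f(x_k)-f(x_* )\ge t_\zeta\}<\exp\left(\frac{\theta}{2\sigma^2}\left(\bar\rho^{2k}\,2\mathcal{V}_P(z_0)-t_\zeta\right)+\frac{\theta d\,\alpha(\vartheta+\alpha L)}{2(1-\bar\rho^2)\left(2-\theta\alpha(\vartheta+\alpha L)\right)}\right),$$ where $\bar\rho^2=R(\theta)$ with $R$ defined in the context. Furthermore, for a given confidence level $\zeta\in(0,1)$ and a constant $\varphi\in(0,1)$, $$\mathbb{P}\left\{f(x_k)-f(x_* )\ge\bar E_{1-\zeta}(\vartheta,\psi)+(\bar{\bar\rho}^{(\varphi)})^k\,2\mathcal{V}_P(z_0)\right\}\le\zeta,$$ where $\bar{\bar\rho}^{(\varphi)}=R(\varphi\theta_u^g)$ and $\bar E_{1-\zeta}(\vartheta,\psi)$ is defined in the context.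
   Context: $0<\mu<L$, $\kappa=L/\mu$, $x_*$ is the unique minimizer of $f$. The noisy generalized momentum method (GMM) with parameters $(\alpha,\beta,\gamma)$ and deterministic initialization $x_0,x_{-1}\in\mathbb{R}^d$ is $$x_{k+1}=(1+\beta)x_k-\beta x_{k-1}-\alpha\left(\nabla f(y_k)+w_{k+1}\right),\qquad y_k=(1+\gamma)x_k-\gamma x_{k-1},\qquad k\ge0.$$ Noise assumption: for each $k$, $w_{k+1}\sim\mathcal{N}(0,\sigma^2I_d)$ for some $\sigma>0$, and $w_{k+1}$ is independent of the $\sigma$-algebra $\mathcal{F}_k$ generated by $x_0,\dots,x_k$. Put $z_k=[x_k^\top,x_{k-1}^\top]^\top$, $z_*=[x_*^\top,x_*^\top]^\top$. Parameter choice. Let $\mathcal{S}_0=\{(1,1)\}$, $\mathcal{S}_+=\{(\vartheta,\psi)\mid\psi>1,\ 1<\vartheta\le2-\frac1\psi\}$, $\mathcal{S}_-=\{(\vartheta,\psi)\mid0\le\psi<1,\ \max\{2-\frac1\psi,\frac1{1+\kappa(1-\psi)}\}\le\vartheta<1\}$ (for $\psi=0$ the maximum is read as $\frac1{1+\kappa}$), $$\mathcal{S}_1=\left\{(\vartheta,\psi)\;\middle|\;\psi\ne1,\ \left[1-\sqrt{\tfrac{(1-\vartheta)\vartheta}{\kappa(1-\psi)}}\right]\left[1-\tfrac{(1-\vartheta)(\mu\psi^2-L(1-\psi)^2)}{L(1-\psi)\vartheta}\right]\le\left[1-\tfrac{(1-\vartheta)\psi}{\kappa(1-\psi)}\right]^2\right\},$$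 $\mathcal{S}_c=(\mathcal{S}_-\cup\mathcal{S}_+)\cap\mathcal{S}_1$. For $(\vartheta,\psi)\in\mathcal{S}_0\cup\mathcal{S}_c$: $\alpha_{\vartheta,\psi}=\frac{1-\vartheta}{L(1-\psi)}$ if $(\vartheta,\psi)\in\mathcal{S}_c$, $\alpha_{\vartheta,\psi}$ is any number in $(0,\frac1L]$ if $(\vartheta,\psi)\in\mathcal{S}_0$; $\beta_{\vartheta,\psi}=\frac{1-\sqrt{\vartheta\alpha_{\vartheta,\psi}\mu}}{1-\alpha_{\vartheta,\psi}\psi\mu}\left[1-\sqrt{\frac{\alpha_{\vartheta,\psi}\mu}{\vartheta}}\right]$; $\gamma_{\vartheta,\psi}=\psi\beta_{\vartheta,\psi}$. With these $\alpha,\beta,\gamma$: $$\mathtt{v}=\frac{2L^2}{\mu}\left(2(\beta-\gamma)^2+(1-\alpha L)^2(1+2\gamma+2\gamma^2)\right)+\frac{\vartheta}{2\alpha}\left(1-\sqrt{\vartheta\alpha\mu}\right),\qquad \theta_u^g=\frac{2\sqrt{\vartheta\mu}}{\alpha\left(8\mathtt{v}\sqrt\alpha+\sqrt{\vartheta\mu}\,(\vartheta+\alpha L)\right)},$$ and for $0<\theta<\theta_u^g$, with $\ell(\theta)=\frac{4\theta\alpha^2\mathtt v}{2-\theta\alpha(\vartheta+\alpha L)}$, $$R(\theta)=\frac12\left(1-\sqrt{\vartheta\alpha\mu}+\ell(\theta)\right)+\frac12\sqrt{\left(1-\sqrt{\vartheta\alpha\mu}+\ell(\theta)\right)^2+4\ell(\theta)}.$$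 For $\varphi\in(0,1)$ put $\theta_\varphi^g=\varphi\theta_u^g$ and $\bar{\bar\rho}^{(\varphi)}=R(\theta_\varphi^g)$. Define $$\bar E_{1-\zeta}(\vartheta,\psi)=\frac{\sigma^2\alpha(\vartheta+\alpha L)}{2}\left(\sqrt{\frac{d}{1-\bar{\bar\rho}^{(\varphi)}}}+\sqrt{2\log(1/\zeta)}\right)^2$$ if $\log(1/\zeta)\le\frac{d}{2(1-\bar{\bar\rho}^{(\varphi)})}\left(\frac{\theta_\varphi^g\alpha(\vartheta+\alpha L)}{2-\theta_\varphi^g\alpha(\vartheta+\alpha L)}\right)^2$, and otherwise $$\bar E_{1-\zeta}(\vartheta,\psi)=\frac{\sigma^2d\,\alpha(\vartheta+\alpha L)}{(1-\bar{\bar\rho}^{(\varphi)})\left(2-\theta_\varphi^g\alpha(\vartheta+\alpha L)\right)}+\frac{2\sigma^2}{\theta_\varphi^g}\log(1/\zeta).$$ Lyapunov function: $\mathcal{V}_P(z_k)=(z_k-z_* )^\top P(z_k-z_* )+f(x_k)-f(x_* )$ with $P=(\tilde p\tilde p^\top)\otimes I_d$, $\tilde p=\left[\sqrt{\frac{\vartheta}{2\alpha}},\ -\sqrt{\frac{\vartheta}{2\alpha}}+\sqrt{\frac\mu2}\right]^\top$. *)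

theory Defs
  imports "HOL-Probability.Probability"
begin

definition grad :: "('v::real_inner \<Rightarrow> real) \<Rightarrow> 'v \<Rightarrow> 'v" where
  "grad f x = (THE D. GDERIV f x :> D)"

definition L_smooth :: "real \<Rightarrow> ('v::real_inner \<Rightarrow> real) \<Rightarrow> bool" where
  "L_smooth L f \<longleftrightarrow> (\<forall>x. \<exists>D. GDERIV f x :> D) \<and> L-lipschitz_on UNIV (grad f)"

definition strongly_convex :: "real \<Rightarrow> ('v::real_inner \<Rightarrow> real) \<Rightarrow> bool" where
  "strongly_convex \<mu> f \<longleftrightarrow>
     (\<forall>x y t. 0 \<le> t \<and> t \<le> 1 \<longrightarrow>
        f (t *\<^sub>R x + (1 - t) *\<^sub>R y)
          \<le> t * f x + (1 - t) * f y - \<mu> / 2 * t * (1 - t) * (norm (x - y))\<^sup>2)"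

text \<open>One trajectory: \<open>x\<close> is indexed by the integers so that the iterate with index \<open>-1\<close> is
  available; its values below \<open>-1\<close> and the noise value \<open>w 0\<close> play no role.\<close>

definition noisy_gmm ::
  "('v::real_inner \<Rightarrow> real) \<Rightarrow> real \<Rightarrow> real \<Rightarrow> real \<Rightarrow> 'v \<Rightarrow> 'v
     \<Rightarrow> (nat \<Rightarrow> 'v) \<Rightarrow> (int \<Rightarrow> 'v) \<Rightarrow> bool" where
  "noisy_gmm f \<alpha> \<beta> \<gamma> x0 xm1 w x \<longleftrightarrow>
     x 0 = x0 \<and> x (-1) = xm1 \<and>
     (\<forall>k::nat.
        let y = (1 + \<gamma>) *\<^sub>R x (int k) - \<gamma> *\<^sub>R x (int k - 1)
        in x (int k + 1) =
             (1 + \<beta>) *\<^sub>R x (int k) - \<beta> *\<^sub>R x (int k - 1) - \<alpha> *\<^sub>R (grad f y + w (Suc k)))"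

text \<open>The density of the normal distribution with mean \<open>0\<close> and covariance matrix
  \<open>\<sigma>\<^sup>2 I\<close> with respect to Lebesgue measure.\<close>

definition isotropic_normal_density :: "real \<Rightarrow> real ^ 'n \<Rightarrow> real" where
  "isotropic_normal_density \<sigma> u =
     exp (- (norm u)\<^sup>2 / (2 * \<sigma>\<^sup>2)) / (2 * pi * \<sigma>\<^sup>2) powr (real CARD('n) / 2)"

definition history_sets :: "'a measure \<Rightarrow> (int \<Rightarrow> 'a \<Rightarrow> 'v::topological_space) \<Rightarrow> nat \<Rightarrow> 'a set set" where
  "history_sets M x k =
     sigma_sets (space M)
       {x (int j) -` A \<inter> space M | j A. j \<le> k \<and> A \<in> sets borel}"

definition gaussian_gradient_noise ::
  "'a measure \<Rightarrow> real \<Rightarrow> (nat \<Rightarrow> 'a \<Rightarrow> real ^ 'n) \<Rightarrow> (int \<Rightarrow> 'a \<Rightarrow> real ^ 'n) \<Rightarrow> bool" where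
  "gaussian_gradient_noise M \<sigma> w x \<longleftrightarrow>
     (\<forall>k. distributed M lborel (w (Suc k)) (\<lambda>u. ennreal (isotropic_normal_density \<sigma> u)) \<and>
          prob_space.indep_set M
            {w (Suc k) -` A \<inter> space M | A. A \<in> sets borel}
            (history_sets M x k))"

text \<open>The parameter pair is written \<open>(\<tau>, \<psi>)\<close>; the first component is not to be confused with
  the risk parameter \<open>\<theta>\<close> used for the rates below.\<close>

definition S_zero :: "(real \<times> real) set" where
  "S_zero = {(1, 1)}"

definition S_plus :: "(real \<times> real) set" where
  "S_plus = {(\<tau>, \<psi>). \<psi> > 1 \<and> 1 < \<tau> \<and> \<tau> \<le> 2 - 1 / \<psi>}"

text \<open>At \<open>\<psi> = 0\<close> the term \<open>2 - 1 / \<psi>\<close> stands for minus infinity, whereas division by zero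
  in HOL would make it \<open>2\<close>.\<close>

definition S_minus :: "real \<Rightarrow> (real \<times> real) set" where
  "S_minus \<kappa> = {(\<tau>, \<psi>). 0 \<le> \<psi> \<and> \<psi> < 1 \<and>
     (if \<psi> = 0 then 1 / (1 + \<kappa>) else max (2 - 1 / \<psi>) (1 / (1 + \<kappa> * (1 - \<psi>)))) \<le> \<tau> \<and> \<tau> < 1}"

definition S_one :: "real \<Rightarrow> real \<Rightarrow> (real \<times> real) set" where
  "S_one L \<mu> = {(\<tau>, \<psi>). \<psi> \<noteq> 1 \<and>
     (let \<kappa> = L / \<mu> in
      (1 - sqrt ((1 - \<tau>) * \<tau> / (\<kappa> * (1 - \<psi>))))
        * (1 - (1 - \<tau>) * (\<mu> * \<psi>\<^sup>2 - L * (1 - \<psi>)\<^sup>2) / (L * (1 - \<psi>) * \<tau>))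
      \<le> (1 - (1 - \<tau>) * \<psi> / (\<kappa> * (1 - \<psi>)))\<^sup>2)}"

definition S_c :: "real \<Rightarrow> real \<Rightarrow> (real \<times> real) set" where
  "S_c L \<mu> = (S_minus (L / \<mu>) \<union> S_plus) \<inter> S_one L \<mu>"

definition gmm_alpha :: "real \<Rightarrow> real \<Rightarrow> real \<Rightarrow> real \<Rightarrow> real \<Rightarrow> bool" where
  "gmm_alpha L \<mu> \<tau> \<psi> \<alpha> \<longleftrightarrow>
     ((\<tau>, \<psi>) \<in> S_c L \<mu> \<longrightarrow> \<alpha> = (1 - \<tau>) / (L * (1 - \<psi>))) \<and>
     ((\<tau>, \<psi>) \<in> S_zero \<longrightarrow> 0 < \<alpha> \<and> \<alpha> \<le> 1 / L)"

definition gmm_beta :: "real \<Rightarrow> real \<Rightarrow> real \<Rightarrow> real \<Rightarrow> real" where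
  "gmm_beta \<mu> \<tau> \<psi> \<alpha> =
     (1 - sqrt (\<tau> * \<alpha> * \<mu>)) / (1 - \<alpha> * \<psi> * \<mu>) * (1 - sqrt (\<alpha> * \<mu> / \<tau>))"

definition gmm_gamma :: "real \<Rightarrow> real \<Rightarrow> real \<Rightarrow> real \<Rightarrow> real" where
  "gmm_gamma \<mu> \<tau> \<psi> \<alpha> = \<psi> * gmm_beta \<mu> \<tau> \<psi> \<alpha>"

definition noise_v :: "real \<Rightarrow> real \<Rightarrow> real \<Rightarrow> real \<Rightarrow> real \<Rightarrow> real" where
  "noise_v L \<mu> \<tau> \<psi> \<alpha> =
     (let \<beta> = gmm_beta \<mu> \<tau> \<psi> \<alpha>; \<gamma> = gmm_gamma \<mu> \<tau> \<psi> \<alpha> in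
      2 * L\<^sup>2 / \<mu> * (2 * (\<beta> - \<gamma>)\<^sup>2 + (1 - \<alpha> * L)\<^sup>2 * (1 + 2 * \<gamma> + 2 * \<gamma>\<^sup>2))
      + \<tau> / (2 * \<alpha>) * (1 - sqrt (\<tau> * \<alpha> * \<mu>)))"

definition theta_u :: "real \<Rightarrow> real \<Rightarrow> real \<Rightarrow> real \<Rightarrow> real \<Rightarrow> real" where
  "theta_u L \<mu> \<tau> \<psi> \<alpha> =
     2 * sqrt (\<tau> * \<mu>)
     / (\<alpha> * (8 * noise_v L \<mu> \<tau> \<psi> \<alpha> * sqrt \<alpha> + sqrt (\<tau> * \<mu>) * (\<tau> + \<alpha> * L)))"

definition ell :: "real \<Rightarrow> real \<Rightarrow> real \<Rightarrow> real \<Rightarrow> real \<Rightarrow> real \<Rightarrow> real" where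
  "ell L \<mu> \<tau> \<psi> \<alpha> \<theta> =
     4 * \<theta> * \<alpha>\<^sup>2 * noise_v L \<mu> \<tau> \<psi> \<alpha> / (2 - \<theta> * \<alpha> * (\<tau> + \<alpha> * L))"

definition rate_R :: "real \<Rightarrow> real \<Rightarrow> real \<Rightarrow> real \<Rightarrow> real \<Rightarrow> real \<Rightarrow> real" where
  "rate_R L \<mu> \<tau> \<psi> \<alpha> \<theta> =
     (let q = 1 - sqrt (\<tau> * \<alpha> * \<mu>); l = ell L \<mu> \<tau> \<psi> \<alpha> \<theta> in
      1 / 2 * (q + l) + 1 / 2 * sqrt ((q + l)\<^sup>2 + 4 * l))"

definition E_bar ::
  "real \<Rightarrow> real \<Rightarrow> real \<Rightarrow> nat \<Rightarrow> real \<Rightarrow> real \<Rightarrow> real \<Rightarrow> real \<Rightarrow> real \<Rightarrow> real" where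
  "E_bar L \<mu> \<sigma> d \<tau> \<psi> \<alpha> \<phi> \<zeta> =
     (let \<theta> = \<phi> * theta_u L \<mu> \<tau> \<psi> \<alpha>;
          r = rate_R L \<mu> \<tau> \<psi> \<alpha> \<theta>;
          c = \<alpha> * (\<tau> + \<alpha> * L)
      in if ln (1 / \<zeta>) \<le> real d / (2 * (1 - r)) * (\<theta> * c / (2 - \<theta> * c))\<^sup>2
         then \<sigma>\<^sup>2 * c / 2 * (sqrt (real d / (1 - r)) + sqrt (2 * ln (1 / \<zeta>)))\<^sup>2
         else \<sigma>\<^sup>2 * real d * c / ((1 - r) * (2 - \<theta> * c)) + 2 * \<sigma>\<^sup>2 / \<theta> * ln (1 / \<zeta>))"

definition kronecker ::
  "real ^ 'k::finite ^ 'i::finite \<Rightarrow> real ^ 'l::finite ^ 'j::finite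
     \<Rightarrow> real ^ ('k::finite \<times> 'l::finite) ^ ('i::finite \<times> 'j::finite)"
    (infixl \<open>\<otimes>\<^sub>K\<close> 70) where
  "A \<otimes>\<^sub>K B = (\<chi> r c. A $ fst r $ fst c * B $ snd r $ snd c)"

text \<open>Vectors of dimension \<open>2 d\<close> are indexed by pairs (block, coordinate), in agreement with
  the Kronecker product.\<close>

definition stack :: "real ^ 'n::finite \<Rightarrow> real ^ 'n::finite \<Rightarrow> real ^ (2 \<times> 'n::finite)" where
  "stack u v = (\<chi> r. (if fst r = 1 then u else v) $ snd r)"

definition p_tilde :: "real \<Rightarrow> real \<Rightarrow> real \<Rightarrow> real ^ 2" where
  "p_tilde \<mu> \<tau> \<alpha> =
     vector [sqrt (\<tau> / (2 * \<alpha>)), - sqrt (\<tau> / (2 * \<alpha>)) + sqrt (\<mu> / 2)]"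

definition P_mat :: "real \<Rightarrow> real \<Rightarrow> real \<Rightarrow> real ^ (2 \<times> 'n::finite) ^ (2 \<times> 'n::finite)" where
  "P_mat \<mu> \<tau> \<alpha> = (\<chi> i j. p_tilde \<mu> \<tau> \<alpha> $ i * p_tilde \<mu> \<tau> \<alpha> $ j)
     \<otimes>\<^sub>K (mat 1 :: real ^ 'n::finite ^ 'n::finite)"

text \<open>The arguments \<open>u\<close> and \<open>v\<close> are the blocks \<open>x\<^sub>k\<close> and \<open>x\<^sub>k\<^sub>-\<^sub>1\<close> of \<open>z\<^sub>k\<close>.\<close>

definition lyapunov ::
  "(real ^ 'n::finite \<Rightarrow> real) \<Rightarrow> real ^ 'n::finite \<Rightarrow> real ^ (2 \<times> 'n::finite) ^ (2 \<times> 'n::finite)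
     \<Rightarrow> real ^ 'n::finite \<Rightarrow> real ^ 'n::finite \<Rightarrow> real" where
  "lyapunov f xs P u v =
     (let z = stack u v; zs = stack xs xs
      in (z - zs) \<bullet> (P *v (z - zs)) + f u - f xs)"

end

theory Submission
  imports Defs
begin

text \<open>The proof combines a deterministic contraction, a Gaussian integral and Markov's inequality.

Write \<open>q = 1 - sqrt (\<tau> * \<alpha> * \<mu>)\<close>, \<open>c = \<alpha> * (\<tau> + \<alpha> * L)\<close>, and \<open>V\<close> for the Lyapunov function.
The parameter sets are made so that a step without noise satisfies \<open>V' \<le> q * V\<close>: after the
smoothness and strong convexity inequalities are inserted, all mixed terms cancel and two squares
with nonpositive coefficients remain (\<open>lyap_gmm_step\<close>). Moving the new iterate by
\<open>- \<alpha> *\<^sub>R w\<close> costs at most \<open>c / 2 * (norm w)\<^sup>2\<close> and a term linear in \<open>w\<close>,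
\<open>- \<alpha> * (w \<bullet> h)\<close>, and \<open>\<alpha>\<^sup>2 * (norm h)\<^sup>2 \<le> 2 * c * V'\<close> because both parts of \<open>h\<close> are dominated by
\<open>V'\<close> (\<open>lyap_perturbed\<close>). For Gaussian \<open>w\<close> the exponential moment of such a quadratic is explicit, and
one step therefore satisfies
  \<open>E exp (s * V_new) \<le> C * exp (s * r * V)\<close> with \<open>s = \<theta> / (2 * \<sigma>\<^sup>2)\<close>,
for every \<open>r \<ge> 2 * q / (2 - \<theta> * c)\<close> (\<open>gaussian_lyap_step\<close>).

The right-hand side has the same form as the left-hand side with \<open>\<theta>\<close> replaced by the smaller
\<open>\<theta> * r\<close>. Since the step holds for all smaller risk parameters and \<open>ln C\<close> is at most linear in
\<open>\<theta>\<close>, it iterates: the constants add up to a geometric series in \<open>r\<close> (\<open>gmm_exp_moment\<close>), and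
Markov's inequality gives the tail bound (\<open>gmm_tail\<close>).

It remains to see that \<open>r = R \<theta>\<close> is permitted. As \<open>R\<^sup>2 = (q + l) * R + l\<close> with \<open>l = ell \<theta>\<close>, the
condition \<open>\<theta> < \<theta>u\<close>, which amounts to \<open>q + 2 * l < 1\<close>, gives \<open>q + 2 * l \<le> R < 1\<close>. So
\<open>2 * q / (2 - \<theta> * c) \<le> R\<close> reduces to \<open>q * (\<tau> + \<alpha> * L) \<le> 8 * \<alpha> * v\<close>
(\<open>noise_v_lower\<close>), an inequality about the parameters alone. Its only delicate case is
\<open>\<alpha> * L > 3 * \<tau>\<close>, where the constraint \<open>S_one\<close> keeps \<open>\<alpha> * L\<close> away from 1
(\<open>admissible_large_step\<close>).

The quantile \<open>E_bar\<close> is the tail bound optimised over risk parameters in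
\<open>(0, \<phi> * \<theta>u]\<close> with the rate frozen at \<open>r = R (\<phi> * \<theta>u)\<close>; freezing is harmless since
\<open>2 * q / (2 - \<theta> * c)\<close> increases with \<open>\<theta>\<close>.\<close>

section \<open>Smooth and strongly convex functions\<close>

lemma grad_eqI:
  assumes "GDERIV f x :> D" shows "grad f x = D"
proof -
  have "D' = D" if "GDERIV f x :> D'" for D'
  proof -
    have "(\<lambda>h. h \<bullet> D') = (\<lambda>h. h \<bullet> D)"
      using that assms unfolding gderiv_def by (rule has_derivative_unique)
    then have "(D' - D) \<bullet> (D' - D) = 0"
      by (metis inner_diff_right right_minus_eq)
    then show ?thesis by simp
  qed
  with assms show ?thesis unfolding grad_def by blast
qed

lemma L_smooth_has_derivative:
  assumes "L_smooth L f"
  shows "(f has_derivative (\<lambda>h. h \<bullet> grad f x)) (at x)"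
  using assms grad_eqI unfolding L_smooth_def gderiv_def by metis

lemma L_smooth_along_line:
  assumes "L_smooth L f"
  shows "((\<lambda>t. f (x + t *\<^sub>R h)) has_real_derivative h \<bullet> grad f (x + t *\<^sub>R h)) (at t)"
proof -
  have "((\<lambda>t. x + t *\<^sub>R h) has_derivative (\<lambda>t. t *\<^sub>R h)) (at t)"
    by (auto intro!: derivative_eq_intros)
  from has_derivative_compose[OF this L_smooth_has_derivative[OF assms]]
  show ?thesis unfolding has_field_derivative_def
    by (simp add: mult_commute_abs)
qed

lemma L_smooth_continuous:
  assumes "L_smooth L f"
  shows "continuous_on UNIV f" "continuous_on UNIV (grad f)"
  using L_smooth_has_derivative[OF assms] assms
  by (auto simp: L_smooth_def intro: continuous_at_imp_continuous_on has_derivative_continuous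
      lipschitz_on_continuous_on)

text \<open>The descent lemma: along the segment from \<open>x\<close> to \<open>y\<close>, the gap between \<open>f\<close> and its quadratic upper
model has nonpositive derivative by Cauchy-Schwarz and the Lipschitz bound on the gradient.\<close>
lemma L_smooth_upper:
  assumes "L_smooth L f"
  shows "f y \<le> f x + grad f x \<bullet> (y - x) + L / 2 * (norm (y - x))\<^sup>2"
proof -
  define h where "h = y - x"
  define \<Phi> where "\<Phi> = (\<lambda>t. f (x + t *\<^sub>R h) - t * (h \<bullet> grad f x) - L / 2 * t\<^sup>2 * (norm h)\<^sup>2)"
  have "\<Phi> 1 \<le> \<Phi> 0"
  proof (rule DERIV_nonpos_imp_nonincreasing[where f = \<Phi> and a = 0 and b = 1])
    fix t :: real assume t: "0 \<le> t" "t \<le> 1"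
    let ?D = "h \<bullet> grad f (x + t *\<^sub>R h) - h \<bullet> grad f x - L * t * (norm h)\<^sup>2"
    have "(\<Phi> has_real_derivative ?D) (at t)"
      unfolding \<Phi>_def
      by (rule derivative_eq_intros L_smooth_along_line[OF assms] refl | simp)+
    moreover have "?D \<le> 0"
    proof -
      have "dist (grad f (x + t *\<^sub>R h)) (grad f x) \<le> L * dist (x + t *\<^sub>R h) x"
        using assms unfolding L_smooth_def by (auto intro: lipschitz_onD)
      then have "norm (grad f (x + t *\<^sub>R h) - grad f x) \<le> L * (t * norm h)"
        using t by (simp add: dist_norm)
      then have "norm h * norm (grad f (x + t *\<^sub>R h) - grad f x) \<le> norm h * (L * (t * norm h))"
        by (intro mult_left_mono) auto
      moreover have "h \<bullet> (grad f (x + t *\<^sub>R h) - grad f x)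
          \<le> norm h * norm (grad f (x + t *\<^sub>R h) - grad f x)"
        by (rule norm_cauchy_schwarz)
      ultimately show ?thesis
        by (simp add: inner_diff_right power2_eq_square mult_ac)
    qed
    ultimately show "\<exists>D. (\<Phi> has_real_derivative D) (at t) \<and> D \<le> 0" by blast
  qed simp
  then show ?thesis by (simp add: \<Phi>_def h_def inner_commute)
qed

text \<open>Dividing the convexity inequality at \<open>t *\<^sub>R y + (1 - t) *\<^sub>R x\<close> by \<open>t\<close> and letting \<open>t\<close> tend to 0
turns the difference quotient into the directional derivative at \<open>x\<close>.\<close>
lemma strongly_convex_lower:
  assumes "strongly_convex \<mu> f" "L_smooth L f"
  shows "f x + grad f x \<bullet> (y - x) + \<mu> / 2 * (norm (y - x))\<^sup>2 \<le> f y"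
proof -
  define h where "h = y - x"
  have "((\<lambda>t. f (x + t *\<^sub>R h)) has_real_derivative h \<bullet> grad f x) (at 0)"
    using L_smooth_along_line[OF assms(2), of x h 0] by simp
  then have "((\<lambda>t. (f (x + t *\<^sub>R h) - f x) / t) \<longlongrightarrow> h \<bullet> grad f x) (at 0)"
    by (simp add: has_field_derivative_iff)
  then have lim: "((\<lambda>t. (f (x + t *\<^sub>R h) - f x) / t) \<longlongrightarrow> h \<bullet> grad f x) (at_right 0)"
    by (rule filterlim_mono) (auto intro: at_le)
  have lim2: "((\<lambda>t. f y - f x - \<mu> / 2 * (1 - t) * (norm h)\<^sup>2) \<longlongrightarrow>
      f y - f x - \<mu> / 2 * (1 - 0) * (norm h)\<^sup>2) (at_right 0)"
    by (intro tendsto_intros)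
  have "\<forall>\<^sub>F t in at_right 0. (f (x + t *\<^sub>R h) - f x) / t \<le> f y - f x - \<mu> / 2 * (1 - t) * (norm h)\<^sup>2"
    unfolding eventually_at_right_field
  proof (intro exI[of _ 1] conjI allI impI)
    fix t :: real assume t: "0 < t" "t < 1"
    have eq: "t *\<^sub>R y + (1 - t) *\<^sub>R x = x + t *\<^sub>R h" by (simp add: h_def algebra_simps)
    have "f (t *\<^sub>R y + (1 - t) *\<^sub>R x) \<le> t * f y + (1 - t) * f x - \<mu> / 2 * t * (1 - t) * (norm (y - x))\<^sup>2"
      using assms(1) t unfolding strongly_convex_def by simp
    then have "f (x + t *\<^sub>R h) - f x \<le> (f y - f x - \<mu> / 2 * (1 - t) * (norm h)\<^sup>2) * t"
      unfolding eq by (simp add: h_def algebra_simps)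
    then show "(f (x + t *\<^sub>R h) - f x) / t \<le> f y - f x - \<mu> / 2 * (1 - t) * (norm h)\<^sup>2"
      using t by (simp add: divide_le_eq)
  qed simp
  then have "h \<bullet> grad f x \<le> f y - f x - \<mu> / 2 * (1 - 0) * (norm h)\<^sup>2"
    using tendsto_le[OF _ lim2 lim] by simp
  then show ?thesis by (simp add: h_def inner_commute)
qed

text \<open>A gradient step of length \<open>1 / L\<close> decreases \<open>f\<close> by \<open>(norm (grad f x))\<^sup>2 / (2 * L)\<close> at least, and it
cannot go below the minimum.\<close>
lemma grad_norm_le_gap:
  assumes "L_smooth L f" "0 < L" "\<And>u. f xs \<le> f u"
  shows "(norm (grad f x))\<^sup>2 \<le> 2 * L * (f x - f xs)"
proof -
  let ?g = "grad f x"
  have "f xs \<le> f (x - (1 / L) *\<^sub>R ?g)" by (rule assms(3))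
  also have "\<dots> \<le> f x - (norm ?g)\<^sup>2 / (2 * L)"
    using L_smooth_upper[OF assms(1), of "x - (1 / L) *\<^sub>R ?g" x] \<open>0 < L\<close>
    by (simp add: dot_square_norm field_simps power2_eq_square)
  finally show ?thesis using \<open>0 < L\<close> by (simp add: field_simps)
qed

section \<open>Consequences of the parameter choice\<close>

text \<open>What the proof needs to know about the parameters, in one form for all the parameter sets and in
terms of the step size: the equation \<open>\<alpha> * L * (1 - \<psi>) = 1 - \<tau>\<close> cancels the product of gradient and momentum
direction in the descent estimate, \<open>\<alpha> * L * \<psi> \<le> 1\<close> makes the squared gradient harmless, and the
last one, which is \<open>S_one\<close>, the squared momentum direction. The bound \<open>\<alpha> * \<mu> \<le> \<tau>\<close> keeps the
momentum parameter nonnegative.\<close>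
definition admissible :: "real \<Rightarrow> real \<Rightarrow> real \<Rightarrow> real \<Rightarrow> real \<Rightarrow> bool" where
  "admissible L \<mu> \<tau> \<psi> \<alpha> \<longleftrightarrow>
     0 < \<mu> \<and> \<mu> < L \<and> 0 < \<tau> \<and> 0 < \<alpha> \<and> 0 \<le> \<psi> \<and> \<alpha> * \<mu> \<le> \<tau> \<and>
     \<alpha> * L * (1 - \<psi>) = 1 - \<tau> \<and> \<alpha> * L * \<psi> \<le> 1 \<and>
     (1 - sqrt (\<tau> * \<alpha> * \<mu>)) * (1 + \<alpha> * (L * (1 - \<psi>)\<^sup>2 - \<mu> * \<psi>\<^sup>2) / \<tau>) \<le> (1 - \<alpha> * \<mu> * \<psi>)\<^sup>2"

text \<open>The lower bounds on \<open>\<tau>\<close> in \<open>S_minus\<close> translate one by one: the bound by \<open>2 - 1 / \<psi>\<close> is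
\<open>\<alpha> * L * \<psi> \<le> 1\<close>, and the bound by \<open>1 / (1 + \<kappa> * (1 - \<psi>))\<close> is \<open>\<alpha> * \<mu> \<le> \<tau>\<close>. On \<open>S_plus\<close> the
upper bound on \<open>\<tau>\<close> is again \<open>\<alpha> * L * \<psi> \<le> 1\<close>, and it implies \<open>\<alpha> * \<mu> \<le> \<tau>\<close> since \<open>\<psi> > 1\<close> and
\<open>\<tau> > 1\<close>.\<close>
lemma admissible_Sc:
  assumes "0 < \<mu>" "\<mu> < L" "(\<tau>, \<psi>) \<in> S_c L \<mu>" "\<alpha> = (1 - \<tau>) / (L * (1 - \<psi>))"
  shows "admissible L \<mu> \<tau> \<psi> \<alpha>"
proof -
  have L: "0 < L" using assms by simp
  have S: "(\<tau>, \<psi>) \<in> S_minus (L / \<mu>) \<or> (\<tau>, \<psi>) \<in> S_plus" and S1: "(\<tau>, \<psi>) \<in> S_one L \<mu>"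
    using assms by (auto simp: S_c_def)
  have ne: "\<psi> \<noteq> 1" using S1 by (simp add: S_one_def)
  have a: "\<alpha> * L * (1 - \<psi>) = 1 - \<tau>" using assms L ne by (simp add: field_simps)
  have basic: "0 < \<tau> \<and> 0 < \<alpha> \<and> 0 \<le> \<psi> \<and> \<alpha> * \<mu> \<le> \<tau> \<and> \<alpha> * L * \<psi> \<le> 1"
    using S
  proof
    assume "(\<tau>, \<psi>) \<in> S_minus (L / \<mu>)"
    then have m: "0 \<le> \<psi>" "\<psi> < 1" "\<tau> < 1" "1 / (1 + L / \<mu> * (1 - \<psi>)) \<le> \<tau>"
      and m2: "\<psi> = 0 \<or> 2 - 1 / \<psi> \<le> \<tau>"
      by (auto simp: S_minus_def split: if_splits)
    have pos: "0 < 1 + L / \<mu> * (1 - \<psi>)" using m L assms(1) by (simp add: add_pos_nonneg)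
    have \<tau>: "0 < \<tau>" using m(4) pos by (meson less_le_trans zero_less_divide_1_iff)
    have \<alpha>: "0 < \<alpha>" using assms(4) L m by simp
    have "1 \<le> \<tau> * (1 + L / \<mu> * (1 - \<psi>))" using m(4) pos by (simp add: divide_le_eq)
    then have "\<alpha> * L * (1 - \<psi>) \<le> \<tau> * (L / \<mu> * (1 - \<psi>))" unfolding a by (simp add: algebra_simps)
    then have "\<alpha> * \<mu> * (L * (1 - \<psi>)) \<le> \<tau> * (L * (1 - \<psi>))" using assms(1) by (simp add: field_simps)
    moreover have "0 < L * (1 - \<psi>)" using L m by simp
    ultimately have "\<alpha> * \<mu> \<le> \<tau>" by (metis mult_le_cancel_right_pos)
    moreover have "\<alpha> * L * \<psi> \<le> 1"
    proof (cases "\<psi> = 0")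
      case False
      then have "2 * \<psi> - 1 \<le> \<tau> * \<psi>" using m m2 by (simp add: field_simps)
      moreover have "(\<alpha> * L * \<psi>) * (1 - \<psi>) = \<psi> * (1 - \<tau>)" using a by algebra
      ultimately have "(\<alpha> * L * \<psi>) * (1 - \<psi>) \<le> 1 * (1 - \<psi>)" by (simp add: algebra_simps)
      then show ?thesis using m by (metis diff_gt_0_iff_gt mult_le_cancel_right_pos)
    qed simp
    ultimately show ?thesis using \<tau> \<alpha> m by simp
  next
    assume "(\<tau>, \<psi>) \<in> S_plus"
    then have p: "1 < \<psi>" "1 < \<tau>" "\<tau> \<le> 2 - 1 / \<psi>" by (auto simp: S_plus_def)
    have \<alpha>: "0 < \<alpha>" using assms(4) L p by (simp add: zero_less_divide_iff mult_less_0_iff)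
    have "\<tau> * \<psi> \<le> 2 * \<psi> - 1" using p by (simp add: field_simps)
    moreover have "(\<alpha> * L * \<psi>) * (\<psi> - 1) = \<psi> * (\<tau> - 1)" using a by algebra
    ultimately have "(\<alpha> * L * \<psi>) * (\<psi> - 1) \<le> 1 * (\<psi> - 1)" by (simp add: algebra_simps)
    then have aL: "\<alpha> * L * \<psi> \<le> 1" using p by (metis diff_gt_0_iff_gt mult_le_cancel_right_pos)
    have "\<alpha> * \<mu> \<le> \<alpha> * L" using \<alpha> assms(2) by (intro mult_left_mono) auto
    also have "\<dots> \<le> \<alpha> * L * \<psi>" using \<alpha> L p by simp
    finally have "\<alpha> * \<mu> \<le> \<tau>" using aL p by linarith
    then show ?thesis using aL p \<alpha> by simp
  qed
  have e1: "(1 - \<tau>) * \<tau> / (L / \<mu> * (1 - \<psi>)) = \<tau> * \<alpha> * \<mu>"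
    and e2: "(1 - \<tau>) * (\<mu> * \<psi>\<^sup>2 - L * (1 - \<psi>)\<^sup>2) / (L * (1 - \<psi>) * \<tau>) = - (\<alpha> * (L * (1 - \<psi>)\<^sup>2 - \<mu> * \<psi>\<^sup>2) / \<tau>)"
    and e3: "(1 - \<tau>) * \<psi> / (L / \<mu> * (1 - \<psi>)) = \<alpha> * \<mu> * \<psi>"
    using L assms(1) ne basic by (auto simp: a[symmetric]) (auto simp: field_simps)
  show ?thesis
    using S1[unfolded S_one_def Let_def mem_Collect_eq prod.case e1 e2 e3] basic a assms(1,2)
    by (simp add: admissible_def)
qed

text \<open>For \<open>\<tau> = \<psi> = 1\<close> the constraint of \<open>S_one\<close> reads
\<open>(1 - sqrt (\<alpha> * \<mu>)) * (1 - \<alpha> * \<mu>) \<le> (1 - \<alpha> * \<mu>)\<^sup>2\<close>, true because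
\<open>\<alpha> * \<mu> \<le> sqrt (\<alpha> * \<mu>)\<close>.\<close>
lemma admissible_S_zero:
  assumes "0 < \<mu>" "\<mu> < L" "0 < \<alpha>" "\<alpha> \<le> 1 / L"
  shows "admissible L \<mu> 1 1 \<alpha>"
proof -
  have aL: "\<alpha> * L \<le> 1" using assms by (simp add: field_simps)
  have "\<alpha> * \<mu> \<le> \<alpha> * L" using assms by simp
  then have m: "\<alpha> * \<mu> \<le> 1" using aL by simp
  then have "\<alpha> * \<mu> \<le> sqrt (\<alpha> * \<mu>)"
    using assms by (intro real_le_rsqrt) (simp add: power2_eq_square mult_le_one mult_left_le)
  then have "(1 - sqrt (\<alpha> * \<mu>)) * (1 - \<alpha> * \<mu>) \<le> (1 - \<alpha> * \<mu>) * (1 - \<alpha> * \<mu>)"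
    using m by (intro mult_right_mono) auto
  then show ?thesis using assms aL m
    by (simp add: admissible_def power2_eq_square)
qed

text \<open>The constraints give \<open>\<tau> \<le> 2 - \<alpha> * L\<close>, so \<open>\<tau> * \<alpha> * \<mu> < (2 - \<alpha> * L) * (\<alpha> * L) \<le> 1\<close>. Hence the
contraction factor \<open>1 - sqrt (\<tau> * \<alpha> * \<mu>)\<close> is positive.\<close>
lemma admissible_bounds:
  assumes "admissible L \<mu> \<tau> \<psi> \<alpha>"
  shows "\<tau> * \<alpha> * \<mu> < 1" "\<alpha> * \<mu> * \<psi> < 1"
proof -
  note A = assms[unfolded admissible_def]
  have lt: "\<alpha> * \<mu> < \<alpha> * L" using A by simp
  have "\<tau> * (\<alpha> * \<mu>) < \<tau> * (\<alpha> * L)" using A lt by simp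
  also have "\<dots> \<le> (2 - \<alpha> * L) * (\<alpha> * L)"
  proof (rule mult_right_mono)
    have "\<tau> = 1 - \<alpha> * L + \<alpha> * L * \<psi>" using A by (simp add: algebra_simps)
    then show "\<tau> \<le> 2 - \<alpha> * L" using A by linarith
    show "0 \<le> \<alpha> * L" using A by simp
  qed
  also have "\<dots> \<le> 1"
    using zero_le_power2[of "1 - \<alpha> * L"] by (simp add: power2_eq_square algebra_simps)
  finally show "\<tau> * \<alpha> * \<mu> < 1" by (simp add: mult_ac)
  show "\<alpha> * \<mu> * \<psi> < 1"
  proof (cases "\<psi> = 0")
    case False
    then have "\<alpha> * \<mu> * \<psi> < \<alpha> * L * \<psi>" using A lt by simp
    then show ?thesis using A by linarith
  qed simp
qed

text \<open>If \<open>\<tau>\<close> is small compared to \<open>\<alpha> * L\<close>, then \<open>\<alpha> * L\<close> cannot be close to 1. Indeed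
\<open>\<alpha> * \<mu> \<le> \<tau>\<close> forces \<open>L / \<mu> > 3\<close>, so a violation would confine \<open>a = \<alpha> * L\<close> to a neighbourhood of 1
and \<open>\<tau>\<close> to \<open>(0, a / 3)\<close>; then \<open>\<psi> = 1 - (1 - \<tau>) / a\<close> is small and the left-hand side of the
\<open>S_one\<close> constraint exceeds 1, while its right-hand side is at most 1.\<close>
lemma admissible_large_step:
  assumes A: "admissible L \<mu> \<tau> \<psi> \<alpha>" and big: "3 * \<tau> < \<alpha> * L"
  shows "1 \<le> 16 * (L / \<mu>) * (1 - \<alpha> * L)\<^sup>2"
proof (rule ccontr)
  define a m lam where "a = \<alpha> * L" and "m = \<alpha> * \<mu>" and "lam = sqrt (\<tau> * \<alpha> * \<mu>)"
  note A' = A[unfolded admissible_def]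
  assume "\<not> ?thesis"
  then have small: "16 * (L / \<mu>) * (1 - a)\<^sup>2 < 1" by (simp add: a_def)
  have m: "0 < m" "m \<le> \<tau>" "m * \<psi> < 1" using A' admissible_bounds[OF A] by (auto simp: m_def)
  have ratio: "L / \<mu> = a / m" using A' by (simp add: a_def m_def)
  have "3 * m < a" using m big by (simp add: a_def)
  then have k3: "3 < L / \<mu>" unfolding ratio using m by (simp add: field_simps)
  have "48 * (1 - a)\<^sup>2 \<le> 16 * (L / \<mu>) * (1 - a)\<^sup>2" using k3 by (intro mult_right_mono) auto
  (* Rational bounds now suffice: 29/200 is just above 1 / sqrt 48, 0.3817 just above
     1.145 / 3, and the final product 0.618 * 1.66 is about 1.026. *)
  then have "(1 - a)\<^sup>2 < 1 / 48" using small by simp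
  also have "\<dots> < (29/200)\<^sup>2" by (simp add: power2_eq_square)
  finally have "\<bar>1 - a\<bar>\<^sup>2 < (29/200)\<^sup>2" by simp
  then have ab: "\<bar>1 - a\<bar> < 29/200" by (rule power2_less_imp_less) simp
  have a: "0 < a" "a < 229 / 200" using ab by linarith+
  have \<tau>: "0 < \<tau>" "\<tau> < 3817/10000" using A' big a by (auto simp: a_def)
  define p where "p = 1 - \<psi>"
  have p: "a * p = 1 - \<tau>" using A' by (simp add: a_def p_def)
  have "27/50 * a \<le> p * a" using p \<tau> a by (simp add: mult.commute)
  then have p54: "27/50 \<le> p" using a by (simp add: mult_le_cancel_right)
  have "p \<le> 1" using A' by (simp add: p_def)
  have psi2: "\<psi>\<^sup>2 \<le> (23/50)\<^sup>2"
    using A' p54 by (intro power_mono) (auto simp: p_def)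
  have "1619/1000 \<le> (1 - \<tau>) / \<tau>" using \<tau> by (simp add: field_simps)
  then have "1619/1000 * (27/50) \<le> (1 - \<tau>) / \<tau> * p" using p54 \<tau> by (intro mult_mono) auto
  also have "(1 - \<tau>) / \<tau> * p = a * p\<^sup>2 / \<tau>" unfolding p[symmetric] by (simp add: power2_eq_square)
  finally have ap: "1619/1000 * (27/50) \<le> a * p\<^sup>2 / \<tau>" .
  have "m * \<psi>\<^sup>2 \<le> \<tau> * \<psi>\<^sup>2" using m by (intro mult_right_mono) auto
  then have mpsi: "m * \<psi>\<^sup>2 / \<tau> \<le> \<psi>\<^sup>2" using \<tau> by (simp add: field_simps)
  define X where "X = 1 + a * p\<^sup>2 / \<tau> - m * \<psi>\<^sup>2 / \<tau>"
  have X: "83/50 \<le> X"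
  proof -
    have "(23/50)\<^sup>2 = (529/2500 :: real)" by (simp add: power2_eq_square)
    then show ?thesis using ap mpsi psi2 unfolding X_def by linarith
  qed
  have "lam \<le> sqrt (\<tau> * \<tau>)" using m \<tau> unfolding lam_def m_def
    by (intro real_sqrt_le_mono) (simp add: mult.assoc)
  then have "309/500 \<le> 1 - lam" using \<tau> by simp
  then have "309/500 * (83/50) \<le> (1 - lam) * X" using X by (intro mult_mono) auto
  moreover have "(1 - lam) * X \<le> (1 - m * \<psi>)\<^sup>2"
  proof -
    have "X = 1 + \<alpha> * (L * (1 - \<psi>)\<^sup>2 - \<mu> * \<psi>\<^sup>2) / \<tau>"
      using \<tau> by (simp add: X_def a_def m_def p_def field_simps)
    then show ?thesis using A' by (simp add: lam_def m_def)
  qed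
  moreover have "(1 - m * \<psi>)\<^sup>2 \<le> 1"
    using m A' by (intro power_le_one) auto
  ultimately show False by simp
qed

lemma gmm_beta_nonneg:
  assumes "admissible L \<mu> \<tau> \<psi> \<alpha>"
  shows "0 \<le> gmm_beta \<mu> \<tau> \<psi> \<alpha>"
proof -
  have "sqrt (\<tau> * \<alpha> * \<mu>) \<le> 1" "sqrt (\<alpha> * \<mu> / \<tau>) \<le> 1"
    using admissible_bounds[OF assms] assms by (auto simp: admissible_def)
  moreover have "\<alpha> * \<psi> * \<mu> < 1" using admissible_bounds(2)[OF assms] by (simp add: mult_ac)
  ultimately show ?thesis by (simp add: gmm_beta_def)
qed

text \<open>This links the noise constant to the bound \<open>\<alpha>\<^sup>2 * (norm h)\<^sup>2 \<le> 2 * c * V'\<close> on the linear noise term.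
The last summand of \<open>noise_v\<close> contributes \<open>4 * \<tau> * q\<close> to the right-hand side, which suffices if
\<open>\<alpha> * L \<le> 3 * \<tau>\<close>; otherwise the summand with \<open>(1 - \<alpha> * L)\<^sup>2\<close> supplies the rest.\<close>
lemma noise_v_lower:
  assumes A: "admissible L \<mu> \<tau> \<psi> \<alpha>"
  shows "(1 - sqrt (\<tau> * \<alpha> * \<mu>)) * (\<tau> + \<alpha> * L) \<le> 8 * \<alpha> * noise_v L \<mu> \<tau> \<psi> \<alpha>"
proof -
  define q a \<beta> \<gamma> where "q = 1 - sqrt (\<tau> * \<alpha> * \<mu>)" and "a = \<alpha> * L"
    and "\<beta> = gmm_beta \<mu> \<tau> \<psi> \<alpha>" and "\<gamma> = gmm_gamma \<mu> \<tau> \<psi> \<alpha>"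
  note A' = A[unfolded admissible_def]
  have \<gamma>: "0 \<le> \<gamma>" using gmm_beta_nonneg[OF A] A' by (simp add: \<gamma>_def gmm_gamma_def)
  have q: "0 \<le> q" "q \<le> 1" using admissible_bounds[OF A] A' by (auto simp: q_def)
  have a: "0 < a" using A' by (simp add: a_def)
  have v: "8 * \<alpha> * noise_v L \<mu> \<tau> \<psi> \<alpha>
      = 16 * a * (L / \<mu>) * (2 * (\<beta> - \<gamma>)\<^sup>2 + (1 - a)\<^sup>2 * (1 + 2 * \<gamma> + 2 * \<gamma>\<^sup>2)) + 4 * \<tau> * q"
    using A' by (simp add: noise_v_def Let_def \<beta>_def \<gamma>_def q_def a_def power2_eq_square[of L] field_simps)
  have "q * (a - 3 * \<tau>) \<le> 16 * a * (L / \<mu>) * (1 - a)\<^sup>2"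
  proof (cases "3 * \<tau> < a")
    case True
    have "q * (a - 3 * \<tau>) \<le> 1 * (a - 3 * \<tau>)" using q True by (intro mult_right_mono) auto
    also have "\<dots> \<le> a * 1" using A' by simp
    also have "\<dots> \<le> a * (16 * (L / \<mu>) * (1 - a)\<^sup>2)"
      using admissible_large_step[OF A] True a unfolding a_def[symmetric] by (intro mult_left_mono) auto
    finally show ?thesis by (simp add: mult_ac)
  next
    case False
    then have "q * (a - 3 * \<tau>) \<le> 0" using q by (simp add: mult_nonneg_nonpos)
    moreover have "0 \<le> 16 * a * (L / \<mu>) * (1 - a)\<^sup>2" using a A' by simp
    ultimately show ?thesis by linarith
  qed
  also have "\<dots> \<le> 16 * a * (L / \<mu>) * (2 * (\<beta> - \<gamma>)\<^sup>2 + (1 - a)\<^sup>2 * (1 + 2 * \<gamma> + 2 * \<gamma>\<^sup>2))"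
  proof (rule mult_left_mono)
    have "(1 - a)\<^sup>2 * 1 \<le> (1 - a)\<^sup>2 * (1 + 2 * \<gamma> + 2 * \<gamma>\<^sup>2)"
      using \<gamma> by (intro mult_left_mono) auto
    then show "(1 - a)\<^sup>2 \<le> 2 * (\<beta> - \<gamma>)\<^sup>2 + (1 - a)\<^sup>2 * (1 + 2 * \<gamma> + 2 * \<gamma>\<^sup>2)"
      by (smt (verit) zero_le_power2)
  qed (use a A' in auto)
  finally show ?thesis unfolding v q_def[symmetric] a_def[symmetric] by (simp add: algebra_simps)
qed

lemma noise_v_pos:
  assumes A: "admissible L \<mu> \<tau> \<psi> \<alpha>"
  shows "0 < noise_v L \<mu> \<tau> \<psi> \<alpha>"
proof -
  have "0 < (1 - sqrt (\<tau> * \<alpha> * \<mu>)) * (\<tau> + \<alpha> * L)"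
    using admissible_bounds[OF A] A by (intro mult_pos_pos add_pos_pos) (auto simp: admissible_def)
  then have "0 < 8 * \<alpha> * noise_v L \<mu> \<tau> \<psi> \<alpha>" using noise_v_lower[OF A] by linarith
  then show ?thesis using A by (simp add: admissible_def zero_less_mult_iff)
qed

lemma theta_u_pos:
  assumes A: "admissible L \<mu> \<tau> \<psi> \<alpha>"
  shows "0 < theta_u L \<mu> \<tau> \<psi> \<alpha>"
  unfolding theta_u_def using noise_v_pos[OF A] A
  by (intro divide_pos_pos mult_pos_pos add_pos_pos) (auto simp: admissible_def)

text \<open>With \<open>l = ell \<theta>\<close>, the bound \<open>\<theta> < theta_u\<close> becomes \<open>2 * l < 1 - q\<close> on multiplication by
\<open>sqrt \<alpha>\<close>, which turns \<open>sqrt (\<tau> * \<mu>)\<close> into \<open>1 - q\<close>. Comparing squares under the root in \<open>rate_R\<close>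
then shows \<open>q + 2 * l \<le> rate_R < 1\<close>.\<close>
lemma rate_R_bounds:
  assumes A: "admissible L \<mu> \<tau> \<psi> \<alpha>"
    and \<theta>: "0 < \<theta>" "\<theta> < theta_u L \<mu> \<tau> \<psi> \<alpha>"
  shows "\<theta> * (\<alpha> * (\<tau> + \<alpha> * L)) < 2"
    "(1 - sqrt (\<tau> * \<alpha> * \<mu>)) * 2 / (2 - \<theta> * (\<alpha> * (\<tau> + \<alpha> * L))) \<le> rate_R L \<mu> \<tau> \<psi> \<alpha> \<theta>"
    "0 < rate_R L \<mu> \<tau> \<psi> \<alpha> \<theta>" "rate_R L \<mu> \<tau> \<psi> \<alpha> \<theta> < 1"
proof -
  define v q c l S where "v = noise_v L \<mu> \<tau> \<psi> \<alpha>" and "q = 1 - sqrt (\<tau> * \<alpha> * \<mu>)"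
    and "c = \<alpha> * (\<tau> + \<alpha> * L)" and "l = ell L \<mu> \<tau> \<psi> \<alpha> \<theta>" and "S = sqrt (\<tau> * \<mu>)"
  note A' = A[unfolded admissible_def]
  have S: "0 < S" "0 < sqrt \<alpha>" "sqrt \<alpha> * sqrt \<alpha> = \<alpha>" using A' by (auto simp: S_def)
  have qS: "1 - q = sqrt \<alpha> * S" by (simp add: q_def S_def real_sqrt_mult)
  have q: "0 < q" using admissible_bounds[OF A] by (simp add: q_def)
  have c: "0 < c" using A' by (simp add: c_def add_pos_pos)
  have qc: "q * c \<le> 8 * \<alpha>\<^sup>2 * v"
  proof -
    have "\<alpha> * (q * (\<tau> + \<alpha> * L)) \<le> \<alpha> * (8 * \<alpha> * v)"
      using noise_v_lower[OF A] A' by (intro mult_left_mono) (auto simp: q_def v_def)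
    then show ?thesis by (simp add: c_def power2_eq_square mult_ac)
  qed
  have v: "0 < v" using noise_v_pos[OF A] by (simp add: v_def)
  have den: "0 < \<alpha> * (8 * v * sqrt \<alpha> + S * (\<tau> + \<alpha> * L))"
    using A' v S by (intro mult_pos_pos add_pos_pos) auto
  have "\<theta> * (\<alpha> * (8 * v * sqrt \<alpha> + S * (\<tau> + \<alpha> * L))) < 2 * S"
    using \<theta> den by (simp add: theta_u_def v_def[symmetric] S_def[symmetric] less_divide_eq)
  then have main: "8 * \<theta> * \<alpha> * v * sqrt \<alpha> < S * (2 - \<theta> * c)" by (simp add: c_def algebra_simps)
  moreover have "0 < 8 * \<theta> * \<alpha> * v * sqrt \<alpha>" using \<theta> A' v S by simp
  ultimately have "0 < S * (2 - \<theta> * c)" by linarith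
  then have \<theta>c: "0 < 2 - \<theta> * c" using S by (simp add: zero_less_mult_iff)
  have "sqrt \<alpha> * (8 * \<theta> * \<alpha> * v * sqrt \<alpha>) < sqrt \<alpha> * (S * (2 - \<theta> * c))"
    using main S by (intro mult_strict_left_mono) auto
  moreover have "sqrt \<alpha> * (8 * \<theta> * \<alpha> * v * sqrt \<alpha>) = 8 * \<theta> * \<alpha>\<^sup>2 * v"
  proof -
    have "sqrt \<alpha> * (8 * \<theta> * \<alpha> * v * sqrt \<alpha>) = 8 * \<theta> * \<alpha> * v * (sqrt \<alpha> * sqrt \<alpha>)" by (simp only: mult_ac)
    then show ?thesis unfolding S(3) by (simp add: power2_eq_square)
  qed
  ultimately have "8 * \<theta> * \<alpha>\<^sup>2 * v < (1 - q) * (2 - \<theta> * c)" by (simp add: qS)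
  moreover have l_eq: "l = 4 * \<theta> * \<alpha>\<^sup>2 * v / (2 - \<theta> * c)"
    by (simp add: l_def ell_def c_def v_def mult.assoc)
  ultimately have l2: "2 * l < 1 - q" using \<theta>c by (simp add: divide_less_eq)
  have l0: "0 < l" unfolding l_eq using \<theta> A' v \<theta>c by simp
  have R: "rate_R L \<mu> \<tau> \<psi> \<alpha> \<theta> = 1 / 2 * (q + l) + 1 / 2 * sqrt ((q + l)\<^sup>2 + 4 * l)"
    by (simp add: rate_R_def Let_def q_def l_def)
  have "l * (q + 2 * l) \<le> l * 1" using l0 l2 by (intro mult_left_mono) auto
  then have "(q + 3 * l)\<^sup>2 \<le> (q + l)\<^sup>2 + 4 * l" by (simp add: power2_eq_square algebra_simps)
  then have "q + 3 * l \<le> sqrt ((q + l)\<^sup>2 + 4 * l)" by (rule real_le_rsqrt)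
  moreover have "q + 2 * l = 1 / 2 * (q + l) + 1 / 2 * (q + 3 * l)" by (simp add: field_simps)
  ultimately have lower: "q + 2 * l \<le> rate_R L \<mu> \<tau> \<psi> \<alpha> \<theta>" unfolding R by simp
  have "(q + l)\<^sup>2 + 4 * l < (2 - (q + l))\<^sup>2" using l2 by (simp add: power2_eq_square algebra_simps)
  then have "sqrt ((q + l)\<^sup>2 + 4 * l) < 2 - (q + l)"
    using l2 l0 q by (intro real_less_lsqrt) auto
  then show "rate_R L \<mu> \<tau> \<psi> \<alpha> \<theta> < 1" unfolding R by (simp add: field_simps)
  show "0 < rate_R L \<mu> \<tau> \<psi> \<alpha> \<theta>" using lower q l0 by simp
  show "\<theta> * (\<alpha> * (\<tau> + \<alpha> * L)) < 2" using \<theta>c by (simp add: c_def)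
  have "q * 2 / (2 - \<theta> * c) = q + \<theta> * (q * c) / (2 - \<theta> * c)" using \<theta>c by (simp add: field_simps)
  also have "\<dots> \<le> q + \<theta> * (8 * \<alpha>\<^sup>2 * v) / (2 - \<theta> * c)"
    using qc \<theta> \<theta>c by (intro add_left_mono divide_right_mono mult_left_mono) auto
  also have "\<dots> = q + 2 * l" by (simp add: l_eq)
  finally show "(1 - sqrt (\<tau> * \<alpha> * \<mu>)) * 2 / (2 - \<theta> * (\<alpha> * (\<tau> + \<alpha> * L))) \<le> rate_R L \<mu> \<tau> \<psi> \<alpha> \<theta>"
    using lower unfolding q_def[symmetric] c_def[symmetric] by linarith
qed

section \<open>Lyapunov descent and its perturbation by noise\<close>

text \<open>The Lyapunov function without coordinates: \<open>P\<close> is the Kronecker product of a rank-one matrix with the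
identity, so its quadratic form is the squared norm of a single linear combination of the blocks.\<close>
definition lyap :: "('v::real_inner \<Rightarrow> real) \<Rightarrow> 'v \<Rightarrow> real \<Rightarrow> real \<Rightarrow> real \<Rightarrow> 'v \<Rightarrow> 'v \<Rightarrow> real" where
  "lyap f xs \<mu> \<tau> \<alpha> u v =
    (norm (sqrt (\<tau> / (2 * \<alpha>)) *\<^sub>R (u - xs) + (sqrt (\<mu> / 2) - sqrt (\<tau> / (2 * \<alpha>))) *\<^sub>R (v - xs)))\<^sup>2
    + (f u - f xs)"

lemma lyapunov_eq_lyap:
  fixes u v xs :: "real ^ 'n"
  shows "lyapunov f xs (P_mat \<mu> \<tau> \<alpha>) u v = lyap f xs \<mu> \<tau> \<alpha> u v"
proof -
  have z: "stack u v - stack xs xs = stack (u - xs) (v - xs)"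
    by (simp add: stack_def vec_eq_iff)
  have quad: "stack a b \<bullet> (P_mat \<mu> \<tau> \<alpha> *v stack a b)
      = (norm (p_tilde \<mu> \<tau> \<alpha> $ 1 *\<^sub>R a + p_tilde \<mu> \<tau> \<alpha> $ 2 *\<^sub>R b))\<^sup>2" for a b :: "real ^ 'n"
  proof -
    let ?p = "p_tilde \<mu> \<tau> \<alpha>"
    have Pz: "(P_mat \<mu> \<tau> \<alpha> *v stack a b) $ (i, j) = ?p $ i * (?p $ 1 * a $ j + ?p $ 2 * b $ j)"
      for i :: 2 and j :: 'n
    proof -
      have "(P_mat \<mu> \<tau> \<alpha> *v stack a b) $ (i, j)
          = (\<Sum>i'\<in>UNIV. \<Sum>j'\<in>UNIV. ?p $ i * ?p $ i' * (if j = j' then 1 else 0) * stack a b $ (i', j'))"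
        by (simp add: matrix_vector_mult_def P_mat_def kronecker_def mat_def
            UNIV_Times_UNIV[symmetric] sum.cartesian_product del: UNIV_Times_UNIV)
           (rule sum.cong; auto)
      also have "\<dots> = (\<Sum>i'\<in>UNIV. ?p $ i * ?p $ i' * stack a b $ (i', j))"
        by (rule sum.cong) (simp_all add: if_distrib if_distribR cong: if_cong)
      finally show ?thesis by (simp add: sum_2 stack_def algebra_simps)
    qed
    have "stack a b \<bullet> (P_mat \<mu> \<tau> \<alpha> *v stack a b)
        = (\<Sum>i\<in>UNIV. \<Sum>j\<in>UNIV. stack a b $ (i, j) * (?p $ i * (?p $ 1 * a $ j + ?p $ 2 * b $ j)))"
      by (simp add: inner_vec_def UNIV_Times_UNIV[symmetric] sum.cartesian_product del: UNIV_Times_UNIV)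
         (rule sum.cong; auto simp: Pz)
    also have "\<dots> = (\<Sum>j\<in>UNIV. (?p $ 1 * a $ j + ?p $ 2 * b $ j) * (?p $ 1 * a $ j + ?p $ 2 * b $ j))"
      by (simp add: sum_2 stack_def sum.distrib[symmetric] algebra_simps)
    also have "\<dots> = (norm (?p $ 1 *\<^sub>R a + ?p $ 2 *\<^sub>R b))\<^sup>2"
      by (simp add: power2_norm_eq_inner inner_vec_def)
    finally show ?thesis .
  qed
  show ?thesis
    by (simp add: lyapunov_def lyap_def Let_def z quad) (simp add: p_tilde_def vector_2)
qed

definition gmm_step :: "('v::real_inner \<Rightarrow> real) \<Rightarrow> real \<Rightarrow> real \<Rightarrow> real \<Rightarrow> 'v \<Rightarrow> 'v \<Rightarrow> 'v" where
  "gmm_step f \<alpha> \<beta> \<gamma> u v =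
     (1 + \<beta>) *\<^sub>R u - \<beta> *\<^sub>R v - \<alpha> *\<^sub>R grad f ((1 + \<gamma>) *\<^sub>R u - \<gamma> *\<^sub>R v)"

text \<open>The two properties for which the momentum parameter is designed. With \<open>\<delta>\<close> the difference of the
last two iterates, the equation cancels the product of \<open>\<delta>\<close> with the error in the descent
estimate, and the inequality controls the square of \<open>\<delta>\<close>; multiplied by \<open>q\<close> and rewritten with the
equation, the latter becomes the constraint of \<open>S_one\<close>.\<close>
lemma momentum_coefficient:
  assumes A: "admissible L \<mu> \<tau> \<psi> \<alpha>"
  defines "\<beta> \<equiv> gmm_beta \<mu> \<tau> \<psi> \<alpha>" and "q \<equiv> 1 - sqrt (\<tau> * \<alpha> * \<mu>)"
    and "s \<equiv> sqrt (\<tau> / (2 * \<alpha>))" and "n \<equiv> sqrt (\<mu> / 2)"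
  shows "s * \<beta> * (1 - \<alpha> * \<mu> * \<psi>) = q * (s - n)"
    and "s\<^sup>2 * \<beta>\<^sup>2 + L / 2 * (\<beta> - \<psi> * \<beta>)\<^sup>2 - \<mu> / 2 * (\<psi> * \<beta>)\<^sup>2 \<le> q * (s - n)\<^sup>2"
proof -
  note A' = A[unfolded admissible_def]
  have pos: "0 < s" "0 < 1 - \<alpha> * \<mu> * \<psi>" "0 < q"
    using A' admissible_bounds[OF A] by (auto simp: s_def q_def)
  have s2: "s\<^sup>2 = \<tau> / (2 * \<alpha>)" using A' by (simp add: s_def)
  have "s * sqrt (\<alpha> * \<mu> / \<tau>) = sqrt (\<tau> / (2 * \<alpha>) * (\<alpha> * \<mu> / \<tau>))"
    by (simp only: s_def real_sqrt_mult)
  also have "\<dots> = n" using A' by (simp add: n_def)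
  finally have sn: "s * (1 - sqrt (\<alpha> * \<mu> / \<tau>)) = s - n" by (simp add: right_diff_distrib)
  have "\<beta> * (1 - \<alpha> * \<mu> * \<psi>) = q * (1 - sqrt (\<alpha> * \<mu> / \<tau>))"
  proof -
    have "\<alpha> * \<psi> * \<mu> = \<alpha> * \<mu> * \<psi>" by simp
    then show ?thesis using pos(2) unfolding \<beta>_def gmm_beta_def q_def by (simp only: nonzero_eq_divide_eq) simp
  qed
  then show eq: "s * \<beta> * (1 - \<alpha> * \<mu> * \<psi>) = q * (s - n)"
    unfolding sn[symmetric] by (simp add: mult_ac)
  let ?B = "1 + \<alpha> * (L * (1 - \<psi>)\<^sup>2 - \<mu> * \<psi>\<^sup>2) / \<tau>"
  have "q * (s\<^sup>2 * \<beta>\<^sup>2 + L / 2 * (\<beta> - \<psi> * \<beta>)\<^sup>2 - \<mu> / 2 * (\<psi> * \<beta>)\<^sup>2) = s\<^sup>2 * \<beta>\<^sup>2 * (q * ?B)"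
    unfolding s2 using A' by (simp add: field_simps power2_eq_square)
  also have "\<dots> \<le> s\<^sup>2 * \<beta>\<^sup>2 * (1 - \<alpha> * \<mu> * \<psi>)\<^sup>2"
    using A' by (intro mult_left_mono) (auto simp: q_def)
  also have "\<dots> = (q * (s - n))\<^sup>2" unfolding eq[symmetric] by (simp add: power_mult_distrib)
  also have "\<dots> = q * (q * (s - n)\<^sup>2)" by (simp add: power2_eq_square)
  finally show "s\<^sup>2 * \<beta>\<^sup>2 + L / 2 * (\<beta> - \<psi> * \<beta>)\<^sup>2 - \<mu> / 2 * (\<psi> * \<beta>)\<^sup>2 \<le> q * (s - n)\<^sup>2"
    using pos by simp
qed

text \<open>Everything is expressed in the error \<open>e\<close>, the difference \<open>\<delta>\<close> of the last two iterates and the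
gradient \<open>g\<close> at the extrapolated point \<open>y\<close>. The upper quadratic model at \<open>y\<close> bounds \<open>f\<close> at the new
iterate, and the lower models at \<open>y\<close>, weighted by \<open>q\<close> and \<open>1 - q\<close>, bound \<open>f\<close> at the old iterate and
at the minimizer. In the resulting quadratic form in \<open>(e, \<delta>, g)\<close> only the squares of \<open>\<delta>\<close> and \<open>g\<close>
survive, with nonpositive coefficients.\<close>
lemma lyap_gmm_step:
  fixes f :: "'v::real_inner \<Rightarrow> real"
  assumes A: "admissible L \<mu> \<tau> \<psi> \<alpha>" and f: "strongly_convex \<mu> f" "L_smooth L f"
  defines "\<beta> \<equiv> gmm_beta \<mu> \<tau> \<psi> \<alpha>" and "\<gamma> \<equiv> gmm_gamma \<mu> \<tau> \<psi> \<alpha>"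
  shows "lyap f xs \<mu> \<tau> \<alpha> (gmm_step f \<alpha> \<beta> \<gamma> u v) u \<le> (1 - sqrt (\<tau> * \<alpha> * \<mu>)) * lyap f xs \<mu> \<tau> \<alpha> u v"
proof -
  note A' = A[unfolded admissible_def]
  define q s n where "q = 1 - sqrt (\<tau> * \<alpha> * \<mu>)" and "s = sqrt (\<tau> / (2 * \<alpha>))" and "n = sqrt (\<mu> / 2)"
  define e \<delta> y g where "e = u - xs" and "\<delta> = u - v" and "y = (1 + \<gamma>) *\<^sub>R u - \<gamma> *\<^sub>R v" and "g = grad f y"
  define u' where "u' = gmm_step f \<alpha> \<beta> \<gamma> u v"
  have \<gamma>: "\<gamma> = \<psi> * \<beta>" by (simp add: \<gamma>_def \<beta>_def gmm_gamma_def)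
  have s2: "s\<^sup>2 = \<tau> / (2 * \<alpha>)" and n2: "n\<^sup>2 = \<mu> / 2" using A' by (auto simp: s_def n_def)
  have "2 * \<alpha> * s * n = sqrt ((2 * \<alpha>)\<^sup>2) * (s * n)"
    using A' by (subst real_sqrt_abs) simp
  also have "\<dots> = sqrt ((2 * \<alpha>)\<^sup>2 * (\<tau> / (2 * \<alpha>) * (\<mu> / 2)))"
    by (simp only: s_def n_def real_sqrt_mult)
  also have "(2 * \<alpha>)\<^sup>2 * (\<tau> / (2 * \<alpha>) * (\<mu> / 2)) = \<tau> * \<alpha> * \<mu>"
    using A' by (simp add: power2_eq_square)
  finally have lam: "1 - q = 2 * \<alpha> * s * n" by (simp add: q_def)
  have q: "0 \<le> q" "q \<le> 1" using admissible_bounds[OF A] A' by (auto simp: q_def)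
  note mc = momentum_coefficient[OF A, folded \<beta>_def q_def s_def n_def]

  have y: "y - xs = e + \<gamma> *\<^sub>R \<delta>" by (simp add: y_def e_def \<delta>_def algebra_simps)
  have uy: "u' - y = (\<beta> - \<gamma>) *\<^sub>R \<delta> - \<alpha> *\<^sub>R g"
    by (simp add: u'_def gmm_step_def y_def[symmetric] g_def) (simp add: y_def \<delta>_def algebra_simps)
  have T': "s *\<^sub>R (u' - xs) + (n - s) *\<^sub>R (u - xs) = n *\<^sub>R e + (s * \<beta>) *\<^sub>R \<delta> - (s * \<alpha>) *\<^sub>R g"
    by (simp add: u'_def gmm_step_def y_def[symmetric] g_def) (simp add: e_def \<delta>_def algebra_simps)
  have T: "s *\<^sub>R (u - xs) + (n - s) *\<^sub>R (v - xs) = n *\<^sub>R e + (s - n) *\<^sub>R \<delta>"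
    by (simp add: e_def \<delta>_def algebra_simps)

  define ee ed dd ge gd gg where "ee = e \<bullet> e" and "ed = e \<bullet> \<delta>" and "dd = \<delta> \<bullet> \<delta>"
    and "ge = g \<bullet> e" and "gd = g \<bullet> \<delta>" and "gg = g \<bullet> g"
  note defs = ee_def ed_def dd_def ge_def gd_def gg_def
  have nT': "(norm (n *\<^sub>R e + (s * \<beta>) *\<^sub>R \<delta> - (s * \<alpha>) *\<^sub>R g))\<^sup>2
      = n\<^sup>2 * ee + s\<^sup>2 * \<beta>\<^sup>2 * dd + s\<^sup>2 * \<alpha>\<^sup>2 * gg + 2 * n * s * \<beta> * ed - 2 * n * s * \<alpha> * ge - 2 * s\<^sup>2 * \<alpha> * \<beta> * gd"
    unfolding power2_norm_eq_inner defs
    by (simp add: inner_add_left inner_add_right inner_diff_left inner_diff_right inner_commute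
        power2_eq_square algebra_simps)
  have nT: "(norm (n *\<^sub>R e + (s - n) *\<^sub>R \<delta>))\<^sup>2 = n\<^sup>2 * ee + (s - n)\<^sup>2 * dd + 2 * n * (s - n) * ed"
    unfolding power2_norm_eq_inner defs
    by (simp add: inner_add_left inner_add_right inner_diff_left inner_diff_right inner_commute
        power2_eq_square algebra_simps)

  have up: "f u' \<le> f y + ((\<beta> - \<gamma>) * gd - \<alpha> * gg)
      + L / 2 * ((\<beta> - \<gamma>)\<^sup>2 * dd - 2 * \<alpha> * (\<beta> - \<gamma>) * gd + \<alpha>\<^sup>2 * gg)"
    using L_smooth_upper[OF f(2), of u' y] unfolding uy g_def[symmetric] power2_norm_eq_inner defs
    by (simp add: inner_diff_left inner_diff_right inner_commute power2_eq_square algebra_simps)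
  have "f y - \<gamma> * gd + \<mu> / 2 * \<gamma>\<^sup>2 * dd \<le> f u"
  proof -
    have "u - y = - (\<gamma> *\<^sub>R \<delta>)" by (simp add: y_def \<delta>_def algebra_simps)
    then show ?thesis
      using strongly_convex_lower[OF f, of y u] unfolding power2_norm_eq_inner
      by (simp add: g_def defs power2_eq_square mult_ac)
  qed
  then have low1: "q * (f y - \<gamma> * gd + \<mu> / 2 * \<gamma>\<^sup>2 * dd) \<le> q * f u" using q by (intro mult_left_mono)
  have xy: "xs - y = - (e + \<gamma> *\<^sub>R \<delta>)" using y by (metis minus_diff_eq)
  have "f y - (ge + \<gamma> * gd) + \<mu> / 2 * (ee + 2 * \<gamma> * ed + \<gamma>\<^sup>2 * dd) \<le> f xs"
    using strongly_convex_lower[OF f, of y xs] unfolding xy g_def[symmetric] power2_norm_eq_inner defs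
    by (simp add: inner_add_left inner_add_right inner_commute power2_eq_square algebra_simps)
  then have low2: "(1 - q) * (f y - (ge + \<gamma> * gd) + \<mu> / 2 * (ee + 2 * \<gamma> * ed + \<gamma>\<^sup>2 * dd)) \<le> (1 - q) * f xs"
    using q by (intro mult_left_mono) auto

  have ed0: "2 * n * s * \<beta> - 2 * q * n * (s - n) - (1 - q) * \<mu> * \<gamma> = 0"
  proof -
    have "(1 - q) * \<mu> * \<gamma> = 2 * n * (s * \<beta> * (\<alpha> * \<mu> * \<psi>))" by (simp add: lam \<gamma>)
    then show ?thesis using mc(1) by algebra
  qed
  have gd0: "- 2 * s\<^sup>2 * \<alpha> * \<beta> + (\<beta> - \<gamma>) * (1 - \<alpha> * L) + q * \<gamma> + (1 - q) * \<gamma> = 0"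
  proof -
    have "2 * s\<^sup>2 * \<alpha> = \<tau>" using A' by (simp add: s2)
    moreover have "\<alpha> * L * (1 - \<psi>) = 1 - \<tau>" using A' by simp
    moreover have "- 2 * s\<^sup>2 * \<alpha> * \<beta> + (\<beta> - \<psi> * \<beta>) * (1 - \<alpha> * L) + q * (\<psi> * \<beta>) + (1 - q) * (\<psi> * \<beta>)
        = \<beta> * (1 - 2 * s\<^sup>2 * \<alpha> - \<alpha> * L * (1 - \<psi>))" by (simp add: algebra_simps)
    ultimately show ?thesis unfolding \<gamma> by simp
  qed
  have gg0: "s\<^sup>2 * \<alpha>\<^sup>2 - \<alpha> + L / 2 * \<alpha>\<^sup>2 \<le> 0"
  proof -
    have "0 < \<alpha>" using A' by simp
    then have "s\<^sup>2 * \<alpha>\<^sup>2 - \<alpha> + L / 2 * \<alpha>\<^sup>2 = \<alpha> / 2 * (\<tau> + \<alpha> * L - 2)"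
      unfolding s2 by (simp add: power2_eq_square field_simps)
    moreover have "\<tau> + \<alpha> * L - 2 \<le> 0"
    proof -
      have "\<alpha> * L - \<alpha> * L * \<psi> = 1 - \<tau>" "\<alpha> * L * \<psi> \<le> 1" using A' by (auto simp: algebra_simps)
      then show ?thesis by linarith
    qed
    ultimately show ?thesis using \<open>0 < \<alpha>\<close> by (simp only:) (rule mult_nonneg_nonpos; simp)
  qed
  have ge0: "- 2 * n * s * \<alpha> + (1 - q) = 0" by (simp add: lam)
  have ee0: "n\<^sup>2 - q * n\<^sup>2 - (1 - q) * (\<mu> / 2) = 0" by (simp add: n2 field_simps)
  have dd0: "s\<^sup>2 * \<beta>\<^sup>2 + L / 2 * (\<beta> - \<gamma>)\<^sup>2 - q * (\<mu> / 2 * \<gamma>\<^sup>2) - (1 - q) * (\<mu> / 2 * \<gamma>\<^sup>2) - q * (s - n)\<^sup>2 \<le> 0"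
  proof -
    have "q * (\<mu> / 2 * \<gamma>\<^sup>2) + (1 - q) * (\<mu> / 2 * \<gamma>\<^sup>2) = \<mu> / 2 * \<gamma>\<^sup>2"
      by (simp only: distrib_right[symmetric]) simp
    then show ?thesis using mc(2)[folded \<gamma>] by linarith
  qed
  have nn: "0 \<le> dd" "0 \<le> gg" by (auto simp: defs)

  have "(norm (n *\<^sub>R e + (s * \<beta>) *\<^sub>R \<delta> - (s * \<alpha>) *\<^sub>R g))\<^sup>2 + (f u' - f xs)
      - q * ((norm (n *\<^sub>R e + (s - n) *\<^sub>R \<delta>))\<^sup>2 + (f u - f xs))
    \<le> (s\<^sup>2 * \<alpha>\<^sup>2 - \<alpha> + L / 2 * \<alpha>\<^sup>2) * gg
      + (s\<^sup>2 * \<beta>\<^sup>2 + L / 2 * (\<beta> - \<gamma>)\<^sup>2 - q * (\<mu> / 2 * \<gamma>\<^sup>2) - (1 - q) * (\<mu> / 2 * \<gamma>\<^sup>2) - q * (s - n)\<^sup>2) * dd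
      + (n\<^sup>2 - q * n\<^sup>2 - (1 - q) * (\<mu> / 2)) * ee
      + (2 * n * s * \<beta> - 2 * q * n * (s - n) - (1 - q) * \<mu> * \<gamma>) * ed
      + (- 2 * n * s * \<alpha> + (1 - q)) * ge
      + (- 2 * s\<^sup>2 * \<alpha> * \<beta> + (\<beta> - \<gamma>) * (1 - \<alpha> * L) + q * \<gamma> + (1 - q) * \<gamma>) * gd"
    unfolding nT nT' using up low1 low2 by (simp add: algebra_simps)
  also have "\<dots> = (s\<^sup>2 * \<alpha>\<^sup>2 - \<alpha> + L / 2 * \<alpha>\<^sup>2) * gg
      + (s\<^sup>2 * \<beta>\<^sup>2 + L / 2 * (\<beta> - \<gamma>)\<^sup>2 - q * (\<mu> / 2 * \<gamma>\<^sup>2) - (1 - q) * (\<mu> / 2 * \<gamma>\<^sup>2) - q * (s - n)\<^sup>2) * dd"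
    unfolding ed0 gd0 ge0 ee0 by simp
  also have "\<dots> \<le> 0" using gg0 dd0 nn by (simp add: add_nonpos_nonpos mult_nonpos_nonneg)
  finally show ?thesis
    unfolding lyap_def u'_def[symmetric] q_def[symmetric] s_def[symmetric] n_def[symmetric] T T' by simp
qed

lemma sum_of_roots_le:
  fixes A B t F :: real
  assumes "0 \<le> A" "0 \<le> B" "0 \<le> t" "0 \<le> F"
  shows "(sqrt A * sqrt t + sqrt B * sqrt F)\<^sup>2 \<le> (A + B) * (t + F)"
proof -
  have "(A + B) * (t + F) - (sqrt A * sqrt t + sqrt B * sqrt F)\<^sup>2 = (sqrt A * sqrt F - sqrt B * sqrt t)\<^sup>2"
    using assms by (simp add: power2_eq_square algebra_simps)
  then show ?thesis by (smt (verit) zero_le_power2)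
qed

text \<open>Both summands of \<open>h u v\<close> are controlled by the Lyapunov function: the first is a multiple of
the vector under its norm, and the squared gradient is at most \<open>2 * L\<close> times the gap in \<open>f\<close>. The
Cauchy-Schwarz inequality adds the two estimates without a loss of a factor 2.\<close>
lemma lyap_perturbed:
  fixes f :: "'v::real_inner \<Rightarrow> real" and \<mu> :: real
  assumes pos: "0 < \<tau>" "0 < \<alpha>" "0 < L" and f: "L_smooth L f" and min: "\<And>u. f xs \<le> f u"
  defines "h \<equiv> \<lambda>u v. (2 * sqrt (\<tau> / (2 * \<alpha>))) *\<^sub>R (sqrt (\<tau> / (2 * \<alpha>)) *\<^sub>R (u - xs)
      + (sqrt (\<mu> / 2) - sqrt (\<tau> / (2 * \<alpha>))) *\<^sub>R (v - xs)) + grad f u"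
  shows "lyap f xs \<mu> \<tau> \<alpha> (u - \<alpha> *\<^sub>R w) v
      \<le> lyap f xs \<mu> \<tau> \<alpha> u v - \<alpha> * (w \<bullet> h u v) + \<alpha> * (\<tau> + \<alpha> * L) / 2 * (norm w)\<^sup>2"
    and "(norm (h u v))\<^sup>2 \<le> 2 * (\<tau> + \<alpha> * L) / \<alpha> * lyap f xs \<mu> \<tau> \<alpha> u v"
proof -
  define s r where "s = sqrt (\<tau> / (2 * \<alpha>))" and "r = sqrt (\<mu> / 2) - s"
  define T where "T = s *\<^sub>R (u - xs) + r *\<^sub>R (v - xs)"
  have h: "h u v = (2 * s) *\<^sub>R T + grad f u" by (simp add: h_def s_def r_def T_def)
  have s2: "s\<^sup>2 = \<tau> / (2 * \<alpha>)" using pos by (simp add: s_def)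
  have V: "lyap f xs \<mu> \<tau> \<alpha> u v = (norm T)\<^sup>2 + (f u - f xs)"
    by (simp add: lyap_def T_def s_def r_def)
  have V': "lyap f xs \<mu> \<tau> \<alpha> (u - \<alpha> *\<^sub>R w) v = (norm (T - (s * \<alpha>) *\<^sub>R w))\<^sup>2 + (f (u - \<alpha> *\<^sub>R w) - f xs)"
  proof -
    have "s *\<^sub>R (u - \<alpha> *\<^sub>R w - xs) + r *\<^sub>R (v - xs) = T - (s * \<alpha>) *\<^sub>R w"
      by (simp add: T_def algebra_simps)
    then show ?thesis by (simp add: lyap_def s_def r_def)
  qed
  have "f (u - \<alpha> *\<^sub>R w) \<le> f u - \<alpha> * (w \<bullet> grad f u) + L / 2 * \<alpha>\<^sup>2 * (norm w)\<^sup>2"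
    using L_smooth_upper[OF f, of "u - \<alpha> *\<^sub>R w" u] pos
    by (simp add: inner_commute power_mult_distrib)
  moreover have "(norm (T - (s * \<alpha>) *\<^sub>R w))\<^sup>2 = (norm T)\<^sup>2 - \<alpha> * (w \<bullet> ((2 * s) *\<^sub>R T)) + s\<^sup>2 * \<alpha>\<^sup>2 * (norm w)\<^sup>2"
    unfolding power2_norm_eq_inner
    by (simp add: inner_diff_left inner_diff_right inner_commute power2_eq_square algebra_simps)
  moreover have "s\<^sup>2 * \<alpha>\<^sup>2 + L / 2 * \<alpha>\<^sup>2 = \<alpha> * (\<tau> + \<alpha> * L) / 2"
    unfolding s2 using pos by (simp add: power2_eq_square field_simps)
  ultimately show "lyap f xs \<mu> \<tau> \<alpha> (u - \<alpha> *\<^sub>R w) v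
      \<le> lyap f xs \<mu> \<tau> \<alpha> u v - \<alpha> * (w \<bullet> h u v) + \<alpha> * (\<tau> + \<alpha> * L) / 2 * (norm w)\<^sup>2"
    unfolding V V' h inner_add_right by (smt (verit) distrib_right distrib_left)
  have F: "0 \<le> f u - f xs" using min by simp
  have "norm (grad f u) \<le> sqrt (2 * L) * sqrt (f u - f xs)"
    using grad_norm_le_gap[OF f _ min, of u] pos unfolding real_sqrt_mult[symmetric]
    by (intro real_le_rsqrt) auto
  moreover have "norm ((2 * s) *\<^sub>R T) = sqrt (4 * s\<^sup>2) * sqrt ((norm T)\<^sup>2)"
  proof -
    have s0: "0 \<le> s" using pos by (simp add: s_def)
    then have "sqrt (4 * s\<^sup>2) = 2 * s" by (intro real_sqrt_unique) (auto simp: power_mult_distrib)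
    then show ?thesis using s0 by simp
  qed
  ultimately have "norm (h u v) \<le> sqrt (4 * s\<^sup>2) * sqrt ((norm T)\<^sup>2) + sqrt (2 * L) * sqrt (f u - f xs)"
    unfolding h by (metis add_mono norm_triangle_ineq order_refl order_trans)
  then have "(norm (h u v))\<^sup>2 \<le> (sqrt (4 * s\<^sup>2) * sqrt ((norm T)\<^sup>2) + sqrt (2 * L) * sqrt (f u - f xs))\<^sup>2"
    by (intro power_mono) auto
  also have "\<dots> \<le> (4 * s\<^sup>2 + 2 * L) * ((norm T)\<^sup>2 + (f u - f xs))"
    using pos F by (intro sum_of_roots_le) auto
  also have "\<dots> = 2 * (\<tau> + \<alpha> * L) / \<alpha> * lyap f xs \<mu> \<tau> \<alpha> u v"
    unfolding V s2 using pos by (simp add: field_simps)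
  finally show "(norm (h u v))\<^sup>2 \<le> 2 * (\<tau> + \<alpha> * L) / \<alpha> * lyap f xs \<mu> \<tau> \<alpha> u v" .
qed

section \<open>Gaussian exponential moments\<close>

lemma nn_integral_lborel_affine:
  fixes t :: "'v::euclidean_space" and c :: real
  assumes [measurable]: "F \<in> borel_measurable borel" and c: "c \<noteq> 0"
  shows "(\<integral>\<^sup>+x. F x \<partial>lborel) = ennreal (\<bar>c\<bar> ^ DIM('v)) * (\<integral>\<^sup>+x. F (t + c *\<^sub>R x) \<partial>lborel)"
  by (subst lborel_affine[OF c, of t])
     (simp add: nn_integral_density nn_integral_distr nn_integral_cmult)

text \<open>Completing the square turns the integrand into a constant times the same Gaussian density at the affine
image \<open>t + \<rho> *\<^sub>R u\<close>, so the integral follows from the scaling of Lebesgue measure. The normalisation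
of the density enters as a hypothesis, since it comes for free from a random variable with this density.\<close>
lemma gaussian_exp_quadratic:
  fixes h :: "real ^ 'n"
  assumes norm1: "(\<integral>\<^sup>+u. ennreal (isotropic_normal_density \<sigma> (u :: real ^ 'n)) \<partial>lborel) = 1"
    and \<sigma>: "0 < \<sigma>" and \<theta>: "\<theta> * c < 2"
  shows "(\<integral>\<^sup>+u. ennreal (isotropic_normal_density \<sigma> u
            * exp (\<theta> / (2 * \<sigma>\<^sup>2) * (c / 2 * (norm u)\<^sup>2 - \<alpha> * (u \<bullet> h)))) \<partial>lborel)
       = ennreal ((1 - \<theta> * c / 2) powr - (real CARD('n) / 2)
            * exp (\<theta>\<^sup>2 * \<alpha>\<^sup>2 * (norm h)\<^sup>2 / (4 * \<sigma>\<^sup>2 * (2 - \<theta> * c))))"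
proof -
  define \<rho> where "\<rho> = sqrt (1 - \<theta> * c / 2)"
  have \<rho>: "0 < \<rho>" and \<rho>2: "\<rho>\<^sup>2 = 1 - \<theta> * c / 2" using \<theta> by (auto simp: \<rho>_def)
  define t where "t = (\<theta> * \<alpha> / (2 * \<rho>)) *\<^sub>R h"
  define K where "K = exp (\<theta>\<^sup>2 * \<alpha>\<^sup>2 * (norm h)\<^sup>2 / (4 * \<sigma>\<^sup>2 * (2 - \<theta> * c)))"
  let ?N = "isotropic_normal_density \<sigma> :: real ^ 'n \<Rightarrow> real"
  have [measurable]: "?N \<in> borel_measurable borel"
    unfolding isotropic_normal_density_def by measurable
  have square: "?N u * exp (\<theta> / (2 * \<sigma>\<^sup>2) * (c / 2 * (norm u)\<^sup>2 - \<alpha> * (u \<bullet> h))) = K * ?N (t + \<rho> *\<^sub>R u)" for u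
  proof -
    have "(norm (t + \<rho> *\<^sub>R u))\<^sup>2 = \<rho>\<^sup>2 * (norm u)\<^sup>2 + 2 * \<rho> * (t \<bullet> u) + (norm t)\<^sup>2"
      unfolding power2_norm_eq_inner
      by (simp add: inner_add_left inner_add_right inner_commute power2_eq_square algebra_simps)
    also have "2 * \<rho> * (t \<bullet> u) = \<theta> * \<alpha> * (u \<bullet> h)"
      using \<rho> by (simp add: t_def inner_commute)
    also have "(norm t)\<^sup>2 = \<theta>\<^sup>2 * \<alpha>\<^sup>2 * (norm h)\<^sup>2 / (4 * \<rho>\<^sup>2)"
      by (simp add: t_def power_mult_distrib power_divide)
    also have "4 * \<rho>\<^sup>2 = 2 * (2 - \<theta> * c)" by (simp add: \<rho>2)
    finally have n: "(norm (t + \<rho> *\<^sub>R u))\<^sup>2 = (1 - \<theta> * c / 2) * (norm u)\<^sup>2 + \<theta> * \<alpha> * (u \<bullet> h)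
        + \<theta>\<^sup>2 * \<alpha>\<^sup>2 * (norm h)\<^sup>2 / (2 * (2 - \<theta> * c))" unfolding \<rho>2 .
    have "- (norm u)\<^sup>2 / (2 * \<sigma>\<^sup>2) + \<theta> / (2 * \<sigma>\<^sup>2) * (c / 2 * (norm u)\<^sup>2 - \<alpha> * (u \<bullet> h))
        = \<theta>\<^sup>2 * \<alpha>\<^sup>2 * (norm h)\<^sup>2 / (4 * \<sigma>\<^sup>2 * (2 - \<theta> * c)) + - (norm (t + \<rho> *\<^sub>R u))\<^sup>2 / (2 * \<sigma>\<^sup>2)"
    proof -
      define E where "E = \<theta>\<^sup>2 * \<alpha>\<^sup>2 * (norm h)\<^sup>2 / (2 * (2 - \<theta> * c))"
      have "\<theta>\<^sup>2 * \<alpha>\<^sup>2 * (norm h)\<^sup>2 / (4 * \<sigma>\<^sup>2 * (2 - \<theta> * c)) = E / (2 * \<sigma>\<^sup>2)"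
        by (simp add: E_def mult_ac)
      then show ?thesis unfolding n E_def[symmetric] using \<sigma> by (simp add: field_simps)
    qed
    then show ?thesis
      unfolding isotropic_normal_density_def K_def
      by (simp add: exp_add[symmetric] times_divide_eq_left times_divide_eq_right)
  qed
  let ?I = "\<integral>\<^sup>+u. ennreal (?N (t + \<rho> *\<^sub>R u)) \<partial>lborel"
  have "1 = ennreal (\<rho> ^ CARD('n)) * ?I"
    using nn_integral_lborel_affine[of "\<lambda>u. ennreal (?N u)" \<rho> t] \<rho> norm1 by simp
  then have "ennreal (inverse (\<rho> ^ CARD('n))) = ennreal (inverse (\<rho> ^ CARD('n))) * (ennreal (\<rho> ^ CARD('n)) * ?I)"
    by simp
  also have "\<dots> = ?I"
    using \<rho> by (simp add: mult.assoc[symmetric] ennreal_mult[symmetric])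
  finally have I: "?I = ennreal (inverse (\<rho> ^ CARD('n)))" ..
  have "(\<integral>\<^sup>+u. ennreal (K * ?N (t + \<rho> *\<^sub>R u)) \<partial>lborel) = ennreal K * ?I"
    by (subst nn_integral_cmult[symmetric]) (auto simp: ennreal_mult' K_def)
  also have "\<dots> = ennreal (K * inverse (\<rho> ^ CARD('n)))"
    unfolding I by (simp add: K_def ennreal_mult')
  also have "inverse (\<rho> ^ CARD('n)) = (1 - \<theta> * c / 2) powr - (real CARD('n) / 2)"
  proof -
    have "\<rho> ^ CARD('n) = ((1 - \<theta> * c / 2) powr (1/2)) powr real CARD('n)"
      using \<rho> \<theta> by (simp add: powr_realpow powr_half_sqrt \<rho>_def)
    then show ?thesis by (simp add: powr_powr powr_minus)
  qed
  finally show ?thesis unfolding square K_def by (simp add: mult.commute)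
qed

lemma powr_neg_le_exp:
  fixes y m :: real
  assumes "0 < y" "0 \<le> m"
  shows "y powr - m \<le> exp (m * (1 / y - 1))"
proof -
  have "- ln y = ln (1 / y)" using assms by (simp add: ln_div)
  also have "\<dots> \<le> 1 / y - 1" using assms by (intro ln_le_minus_one) auto
  finally have "m * (- ln y) \<le> m * (1 / y - 1)" using assms by (intro mult_left_mono)
  then show ?thesis using assms by (simp add: powr_def)
qed

lemma lyap_nonneg:
  assumes "\<And>u. f xs \<le> f u" shows "0 \<le> lyap f xs \<mu> \<tau> \<alpha> u v"
  using assms[of u] by (simp add: lyap_def)

text \<open>The integral of the Gaussian step multiplies the noiseless value \<open>V'\<close> in the exponent by
\<open>1 + \<theta> * c / (2 - \<theta> * c) = 2 / (2 - \<theta> * c)\<close>, and descent replaces \<open>V'\<close> by \<open>q * V\<close>. The rate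
and the constant are taken at the largest risk parameter \<open>\<Theta>\<close>, which makes the bound uniform in
\<open>\<theta> \<le> \<Theta>\<close> and the logarithm of the constant linear in \<open>\<theta>\<close>, as the iteration requires.\<close>
lemma gaussian_lyap_step:
  fixes f :: "real ^ 'n \<Rightarrow> real" and u v :: "real ^ 'n"
  assumes A: "admissible L \<mu> \<tau> \<psi> \<alpha>" and f: "strongly_convex \<mu> f" "L_smooth L f"
    and min: "\<And>u. f xs \<le> f u" and \<sigma>: "0 < \<sigma>"
    and norm1: "(\<integral>\<^sup>+u. ennreal (isotropic_normal_density \<sigma> (u :: real ^ 'n)) \<partial>lborel) = 1"
  defines "c \<equiv> \<alpha> * (\<tau> + \<alpha> * L)" and "\<beta> \<equiv> gmm_beta \<mu> \<tau> \<psi> \<alpha>" and "\<gamma> \<equiv> gmm_gamma \<mu> \<tau> \<psi> \<alpha>"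
  assumes \<theta>: "0 < \<theta>" "\<theta> \<le> \<Theta>" "\<Theta> * c < 2"
    and r: "(1 - sqrt (\<tau> * \<alpha> * \<mu>)) * 2 / (2 - \<Theta> * c) \<le> r"
  shows "(\<integral>\<^sup>+w. ennreal (isotropic_normal_density \<sigma> w)
            * ennreal (exp (\<theta> / (2 * \<sigma>\<^sup>2) * lyap f xs \<mu> \<tau> \<alpha> (gmm_step f \<alpha> \<beta> \<gamma> u v - \<alpha> *\<^sub>R w) u)) \<partial>lborel)
      \<le> ennreal (exp (\<theta> * (real CARD('n) * c / (2 * (2 - \<Theta> * c))))
            * exp (\<theta> * r / (2 * \<sigma>\<^sup>2) * lyap f xs \<mu> \<tau> \<alpha> u v))"
proof -
  note A' = A[unfolded admissible_def]
  define q where "q = 1 - sqrt (\<tau> * \<alpha> * \<mu>)"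
  define b where "b = gmm_step f \<alpha> \<beta> \<gamma> u v"
  define V Vb where "V = lyap f xs \<mu> \<tau> \<alpha> u v" and "Vb = lyap f xs \<mu> \<tau> \<alpha> b u"
  define h where "h = (2 * sqrt (\<tau> / (2 * \<alpha>))) *\<^sub>R (sqrt (\<tau> / (2 * \<alpha>)) *\<^sub>R (b - xs)
      + (sqrt (\<mu> / 2) - sqrt (\<tau> / (2 * \<alpha>))) *\<^sub>R (u - xs)) + grad f b"
  have pos: "0 < \<tau>" "0 < \<alpha>" "0 < L" using A' by auto
  have c: "0 < c" using pos by (simp add: c_def add_pos_pos)
  have V0: "0 \<le> V" "0 \<le> Vb" using lyap_nonneg[where f = f and xs = xs, OF min] by (auto simp: V_def Vb_def)
  have "\<theta> * c \<le> \<Theta> * c" using \<theta> c by simp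
  then have \<theta>c: "\<theta> * c < 2" "0 < 2 - \<theta> * c" "2 - \<Theta> * c \<le> 2 - \<theta> * c" "0 < 2 - \<Theta> * c" using \<theta> by auto
  have descent: "Vb \<le> q * V"
    using lyap_gmm_step[OF A f, of xs u v] by (simp add: Vb_def V_def b_def q_def \<beta>_def \<gamma>_def)
  note pert = lyap_perturbed[where \<mu> = \<mu> and u = b and v = u, OF pos f(2) min, folded h_def Vb_def c_def]
  have le: "isotropic_normal_density \<sigma> w * exp (\<theta> / (2 * \<sigma>\<^sup>2) * lyap f xs \<mu> \<tau> \<alpha> (b - \<alpha> *\<^sub>R w) u)
      \<le> exp (\<theta> / (2 * \<sigma>\<^sup>2) * Vb) * (isotropic_normal_density \<sigma> w
          * exp (\<theta> / (2 * \<sigma>\<^sup>2) * (c / 2 * (norm w)\<^sup>2 - \<alpha> * (w \<bullet> h))))" for w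
  proof -
    have "lyap f xs \<mu> \<tau> \<alpha> (b - \<alpha> *\<^sub>R w) u \<le> Vb + (c / 2 * (norm w)\<^sup>2 - \<alpha> * (w \<bullet> h))"
      using pert(1)[of w] by simp
    then have "\<theta> / (2 * \<sigma>\<^sup>2) * lyap f xs \<mu> \<tau> \<alpha> (b - \<alpha> *\<^sub>R w) u
        \<le> \<theta> / (2 * \<sigma>\<^sup>2) * (Vb + (c / 2 * (norm w)\<^sup>2 - \<alpha> * (w \<bullet> h)))"
      using \<theta> by (intro mult_left_mono) auto
    then have "exp (\<theta> / (2 * \<sigma>\<^sup>2) * lyap f xs \<mu> \<tau> \<alpha> (b - \<alpha> *\<^sub>R w) u)
        \<le> exp (\<theta> / (2 * \<sigma>\<^sup>2) * Vb) * exp (\<theta> / (2 * \<sigma>\<^sup>2) * (c / 2 * (norm w)\<^sup>2 - \<alpha> * (w \<bullet> h)))"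
      by (simp add: exp_add[symmetric] distrib_left)
    then have "isotropic_normal_density \<sigma> w * exp (\<theta> / (2 * \<sigma>\<^sup>2) * lyap f xs \<mu> \<tau> \<alpha> (b - \<alpha> *\<^sub>R w) u)
        \<le> isotropic_normal_density \<sigma> w * (exp (\<theta> / (2 * \<sigma>\<^sup>2) * Vb) * exp (\<theta> / (2 * \<sigma>\<^sup>2) * (c / 2 * (norm w)\<^sup>2 - \<alpha> * (w \<bullet> h))))"
      by (rule mult_left_mono) (simp add: isotropic_normal_density_def)
    then show ?thesis by (simp only: mult_ac)
  qed
  have [measurable]: "isotropic_normal_density \<sigma> \<in> borel_measurable (borel :: (real ^ 'n) measure)"
    unfolding isotropic_normal_density_def by measurable
  have "(\<integral>\<^sup>+w. ennreal (isotropic_normal_density \<sigma> w)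
            * ennreal (exp (\<theta> / (2 * \<sigma>\<^sup>2) * lyap f xs \<mu> \<tau> \<alpha> (b - \<alpha> *\<^sub>R w) u)) \<partial>lborel)
      \<le> (\<integral>\<^sup>+w. ennreal (exp (\<theta> / (2 * \<sigma>\<^sup>2) * Vb)) * ennreal (isotropic_normal_density \<sigma> w
            * exp (\<theta> / (2 * \<sigma>\<^sup>2) * (c / 2 * (norm w)\<^sup>2 - \<alpha> * (w \<bullet> h)))) \<partial>lborel)"
    using le by (intro nn_integral_mono) (simp add: ennreal_mult''[symmetric] ennreal_mult'[symmetric] ennreal_leI)
  also have "\<dots> = ennreal (exp (\<theta> / (2 * \<sigma>\<^sup>2) * Vb)) * (\<integral>\<^sup>+w. ennreal (isotropic_normal_density \<sigma> w
            * exp (\<theta> / (2 * \<sigma>\<^sup>2) * (c / 2 * (norm w)\<^sup>2 - \<alpha> * (w \<bullet> h)))) \<partial>lborel)"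
    by (rule nn_integral_cmult) measurable
  also have "\<dots> = ennreal (exp (\<theta> / (2 * \<sigma>\<^sup>2) * Vb) * ((1 - \<theta> * c / 2) powr - (real CARD('n) / 2)
            * exp (\<theta>\<^sup>2 * \<alpha>\<^sup>2 * (norm h)\<^sup>2 / (4 * \<sigma>\<^sup>2 * (2 - \<theta> * c)))))"
    unfolding gaussian_exp_quadratic[OF norm1 \<sigma> \<theta>c(1)] by (simp add: ennreal_mult')
  also have "\<dots> \<le> ennreal (exp (\<theta> * (real CARD('n) * c / (2 * (2 - \<Theta> * c)))) * exp (\<theta> * r / (2 * \<sigma>\<^sup>2) * V))"
  proof (rule ennreal_leI)
    have "\<theta>\<^sup>2 * \<alpha>\<^sup>2 * (norm h)\<^sup>2 / (4 * \<sigma>\<^sup>2 * (2 - \<theta> * c))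
        \<le> \<theta>\<^sup>2 * \<alpha>\<^sup>2 * (2 * (\<tau> + \<alpha> * L) / \<alpha> * Vb) / (4 * \<sigma>\<^sup>2 * (2 - \<theta> * c))"
      using pert(2) \<theta>c \<sigma> by (intro divide_right_mono mult_left_mono) auto
    also have "\<dots> = \<theta> / (2 * \<sigma>\<^sup>2) * Vb * (\<theta> * c / (2 - \<theta> * c))"
    proof -
      have "\<alpha>\<^sup>2 * (2 * (\<tau> + \<alpha> * L) / \<alpha> * Vb) = 2 * c * Vb"
        using pos by (simp add: c_def power2_eq_square)
      then have "\<theta>\<^sup>2 * \<alpha>\<^sup>2 * (2 * (\<tau> + \<alpha> * L) / \<alpha> * Vb) = \<theta>\<^sup>2 * (2 * c * Vb)"
        by (simp only: mult.assoc)
      moreover have "\<theta>\<^sup>2 * (2 * c * Vb) / (4 * \<sigma>\<^sup>2 * D) = \<theta> / (2 * \<sigma>\<^sup>2) * Vb * (\<theta> * c / D)" for D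
        by (simp add: power2_eq_square mult_ac)
      ultimately show ?thesis by (simp only:)
    qed
    finally have "\<theta> / (2 * \<sigma>\<^sup>2) * Vb + \<theta>\<^sup>2 * \<alpha>\<^sup>2 * (norm h)\<^sup>2 / (4 * \<sigma>\<^sup>2 * (2 - \<theta> * c))
        \<le> \<theta> / (2 * \<sigma>\<^sup>2) * Vb * (1 + \<theta> * c / (2 - \<theta> * c))" by (simp add: distrib_left)
    also have "1 + \<theta> * c / (2 - \<theta> * c) = 2 / (2 - \<theta> * c)" using \<theta>c by (simp add: field_simps)
    also have "\<theta> / (2 * \<sigma>\<^sup>2) * Vb * (2 / (2 - \<theta> * c)) \<le> \<theta> / (2 * \<sigma>\<^sup>2) * Vb * (2 / (2 - \<Theta> * c))"
      using \<theta> \<theta>c V0 by (intro mult_left_mono divide_left_mono) auto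
    also have "\<dots> \<le> \<theta> / (2 * \<sigma>\<^sup>2) * (q * V) * (2 / (2 - \<Theta> * c))"
      using \<theta> \<theta>c descent by (intro mult_right_mono mult_left_mono) auto
    also have "\<dots> = \<theta> / (2 * \<sigma>\<^sup>2) * V * (q * 2 / (2 - \<Theta> * c))" by simp
    also have "\<dots> \<le> \<theta> / (2 * \<sigma>\<^sup>2) * V * r"
      using r \<theta> V0 by (intro mult_left_mono) (auto simp: q_def)
    finally have e: "\<theta> / (2 * \<sigma>\<^sup>2) * Vb + \<theta>\<^sup>2 * \<alpha>\<^sup>2 * (norm h)\<^sup>2 / (4 * \<sigma>\<^sup>2 * (2 - \<theta> * c))
        \<le> \<theta> * r / (2 * \<sigma>\<^sup>2) * V" by (simp add: mult_ac)
    have "(1 - \<theta> * c / 2) powr - (real CARD('n) / 2) \<le> exp (real CARD('n) / 2 * (1 / (1 - \<theta> * c / 2) - 1))"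
      using \<theta>c by (intro powr_neg_le_exp) auto
    also have "1 / (1 - \<theta> * c / 2) - 1 = \<theta> * c / (2 - \<theta> * c)" using \<theta>c by (simp add: field_simps)
    also have "real CARD('n) / 2 * (\<theta> * c / (2 - \<theta> * c)) \<le> real CARD('n) / 2 * (\<theta> * c / (2 - \<Theta> * c))"
    proof (rule mult_left_mono)
      show "\<theta> * c / (2 - \<theta> * c) \<le> \<theta> * c / (2 - \<Theta> * c)"
        using \<theta>(1) c by (intro divide_left_mono[OF \<theta>c(3)] mult_pos_pos[OF \<theta>c(2,4)]) simp
    qed simp
    finally have p: "(1 - \<theta> * c / 2) powr - (real CARD('n) / 2) \<le> exp (\<theta> * (real CARD('n) * c / (2 * (2 - \<Theta> * c))))"
      by (simp add: mult_ac)
    have "exp (\<theta> / (2 * \<sigma>\<^sup>2) * Vb) * ((1 - \<theta> * c / 2) powr - (real CARD('n) / 2)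
            * exp (\<theta>\<^sup>2 * \<alpha>\<^sup>2 * (norm h)\<^sup>2 / (4 * \<sigma>\<^sup>2 * (2 - \<theta> * c))))
        = (1 - \<theta> * c / 2) powr - (real CARD('n) / 2)
          * exp (\<theta> / (2 * \<sigma>\<^sup>2) * Vb + \<theta>\<^sup>2 * \<alpha>\<^sup>2 * (norm h)\<^sup>2 / (4 * \<sigma>\<^sup>2 * (2 - \<theta> * c)))"
      unfolding exp_add by (simp only: mult_ac)
    also have "\<dots> \<le> exp (\<theta> * (real CARD('n) * c / (2 * (2 - \<Theta> * c)))) * exp (\<theta> * r / (2 * \<sigma>\<^sup>2) * V)"
      using p e by (intro mult_mono) auto
    finally show "exp (\<theta> / (2 * \<sigma>\<^sup>2) * Vb) * ((1 - \<theta> * c / 2) powr - (real CARD('n) / 2)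
            * exp (\<theta>\<^sup>2 * \<alpha>\<^sup>2 * (norm h)\<^sup>2 / (4 * \<sigma>\<^sup>2 * (2 - \<theta> * c))))
        \<le> exp (\<theta> * (real CARD('n) * c / (2 * (2 - \<Theta> * c)))) * exp (\<theta> * r / (2 * \<sigma>\<^sup>2) * V)" .
  qed
  finally show ?thesis unfolding b_def V_def .
qed

text \<open>Conditioning on \<open>X\<close>: independence makes the joint law a product measure, so \<open>w\<close> may be integrated out
first against its density.\<close>
lemma (in prob_space) nn_integral_indep_density:
  fixes X :: "'a \<Rightarrow> 'b::topological_space" and w :: "'a \<Rightarrow> 'c::euclidean_space"
  assumes indep: "indep_set {w -` B \<inter> space M | B. B \<in> sets borel} H"
    and XH: "\<And>A. A \<in> sets borel \<Longrightarrow> X -` A \<inter> space M \<in> H"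
    and w: "distributed M lborel w g"
    and G[measurable]: "G \<in> borel_measurable (borel \<Otimes>\<^sub>M borel)"
  shows "(\<integral>\<^sup>+\<omega>. G (X \<omega>, w \<omega>) \<partial>M) = (\<integral>\<^sup>+\<omega>. (\<integral>\<^sup>+u. g u * G (X \<omega>, u) \<partial>lborel) \<partial>M)"
proof -
  have [measurable]: "random_variable borel X"
    using XH indep_setD_ev2[OF indep] by (intro measurableI) auto
  have [measurable]: "random_variable borel w" using distributed_measurable[OF w] by simp
  have [measurable]: "g \<in> borel_measurable borel" using distributed_borel_measurable[OF w] by simp
  interpret W: prob_space "distr M borel w" by (rule prob_space_distr) measurable
  interpret X: prob_space "distr M borel X" by (rule prob_space_distr) measurable
  have D: "distr M borel X \<Otimes>\<^sub>M distr M borel w = distr M (borel \<Otimes>\<^sub>M borel) (\<lambda>\<omega>. (X \<omega>, w \<omega>))"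
  proof (rule pair_measure_eqI)
    fix A B assume "A \<in> sets (distr M borel X)" "B \<in> sets (distr M borel w)"
    then have AB[measurable]: "A \<in> sets borel" "B \<in> sets borel" by auto
    have "(\<lambda>\<omega>. (X \<omega>, w \<omega>)) -` (A \<times> B) \<inter> space M = (w -` B \<inter> space M) \<inter> (X -` A \<inter> space M)" by auto
    moreover have "prob ((w -` B \<inter> space M) \<inter> (X -` A \<inter> space M))
        = prob (w -` B \<inter> space M) * prob (X -` A \<inter> space M)"
      using AB by (intro indep_setD[OF indep _ XH]) auto
    ultimately show "emeasure (distr M borel X) A * emeasure (distr M borel w) B
        = emeasure (distr M (borel \<Otimes>\<^sub>M borel) (\<lambda>\<omega>. (X \<omega>, w \<omega>))) (A \<times> B)"
      by (simp add: emeasure_distr emeasure_eq_measure ennreal_mult[symmetric] mult.commute)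
  qed (simp_all add: X.sigma_finite_measure_axioms W.sigma_finite_measure_axioms cong: sets_pair_measure_cong)
  have dw: "distr M borel w = density lborel g"
    using distributed_distr_eq_density[OF w] by (metis distr_cong sets_lborel)
  have "(\<integral>\<^sup>+\<omega>. G (X \<omega>, w \<omega>) \<partial>M) = (\<integral>\<^sup>+p. G p \<partial>(distr M borel X \<Otimes>\<^sub>M distr M borel w))"
    unfolding D by (subst nn_integral_distr) auto
  also have "\<dots> = (\<integral>\<^sup>+x. \<integral>\<^sup>+u. G (x, u) \<partial>distr M borel w \<partial>distr M borel X)"
    by (rule W.nn_integral_fst[symmetric]) simp
  also have "\<dots> = (\<integral>\<^sup>+\<omega>. \<integral>\<^sup>+u. G (X \<omega>, u) \<partial>distr M borel w \<partial>M)"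
    by (subst nn_integral_distr) (auto intro!: W.borel_measurable_nn_integral)
  also have "\<dots> = (\<integral>\<^sup>+\<omega>. (\<integral>\<^sup>+u. g u * G (X \<omega>, u) \<partial>lborel) \<partial>M)"
    unfolding dw
    by (intro nn_integral_cong nn_integral_density) measurable
  finally show ?thesis .
qed

section \<open>Exponential moments along the trajectory and tail bounds\<close>

lemma noisy_gmm_Suc:
  assumes "noisy_gmm f \<alpha> \<beta> \<gamma> x0 xm1 w x"
  shows "x (int (Suc k)) = gmm_step f \<alpha> \<beta> \<gamma> (x (int k)) (x (int k - 1)) - \<alpha> *\<^sub>R w (Suc k)"
  using assms unfolding noisy_gmm_def gmm_step_def Let_def
  by (simp add: add.commute[of 1] scaleR_add_right diff_diff_add)

lemma gmm_step_measurable: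
  fixes f :: "real ^ 'n \<Rightarrow> real"
  assumes "L_smooth L f"
  shows "(\<lambda>p. gmm_step f \<alpha> \<beta> \<gamma> (fst p) (snd p)) \<in> borel_measurable borel"
proof -
  have [measurable]: "grad f \<in> borel_measurable borel"
    using L_smooth_continuous(2)[OF assms] by (rule borel_measurable_continuous_onI)
  show ?thesis unfolding gmm_step_def borel_prod[symmetric] by measurable
qed

text \<open>The history consists of the iterates with nonnegative index only; for \<open>k = 0\<close> the older block of the
state is the deterministic starting value, which is measurable for any history.\<close>
lemma state_in_history:
  fixes x :: "int \<Rightarrow> 'a \<Rightarrow> 'v::{topological_space, second_countable_topology}"
  assumes start: "\<And>\<omega>. \<omega> \<in> space M \<Longrightarrow> x (-1) \<omega> = xm1"
    and A: "A \<in> sets borel"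
  shows "(\<lambda>\<omega>. (x (int k) \<omega>, x (int k - 1) \<omega>)) -` A \<inter> space M \<in> history_sets M x k"
proof -
  define G where "G = {x (int j) -` A \<inter> space M | j A. j \<le> k \<and> A \<in> sets borel}"
  define H where "H = sigma (space M) G"
  have G: "G \<subseteq> Pow (space M)" by (auto simp: G_def)
  have H: "space H = space M" "sets H = history_sets M x k"
    using G by (auto simp: H_def history_sets_def G_def sets_measure_of)
  have xH: "x (int j) \<in> borel_measurable H" if "j \<le> k" for j
  proof (rule measurableI)
    fix A :: "'v set" assume "A \<in> sets borel"
    then have "x (int j) -` A \<inter> space M \<in> G" using that by (auto simp: G_def)
    then show "x (int j) -` A \<inter> space H \<in> sets H" unfolding H by (auto simp: history_sets_def G_def)
  qed simp
  have x1H: "x (int k - 1) \<in> borel_measurable H"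
  proof (cases k)
    case 0
    have "x (-1) \<in> borel_measurable H \<longleftrightarrow> (\<lambda>_. xm1) \<in> borel_measurable H"
      using start by (intro measurable_cong) (simp add: H)
    then show ?thesis using 0 by simp
  next
    case (Suc j)
    then show ?thesis using xH[of j] by simp
  qed
  have "(\<lambda>\<omega>. (x (int k) \<omega>, x (int k - 1) \<omega>)) \<in> borel_measurable H"
    using xH[of k] x1H unfolding borel_prod[symmetric] by (intro measurable_Pair) auto
  from measurable_sets[OF this A] show ?thesis by (simp add: H)
qed

text \<open>The induction is over \<open>k\<close> for all risk parameters below \<open>\<Theta>\<close> at once: a step from \<open>k + 1\<close> to \<open>k\<close>
shrinks \<open>\<theta>\<close> to \<open>\<theta> * r\<close>, so that the constants contribute \<open>1 + r * (1 + r * \<dots>)\<close>.\<close>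
lemma (in prob_space) gmm_exp_moment:
  fixes f :: "real ^ 'n \<Rightarrow> real" and w :: "nat \<Rightarrow> 'a \<Rightarrow> real ^ 'n" and x :: "int \<Rightarrow> 'a \<Rightarrow> real ^ 'n"
  assumes A: "admissible L \<mu> \<tau> \<psi> \<alpha>" and f: "strongly_convex \<mu> f" "L_smooth L f"
    and min: "\<And>u. f xs \<le> f u" and \<sigma>: "0 < \<sigma>"
  defines "c \<equiv> \<alpha> * (\<tau> + \<alpha> * L)" and "\<beta> \<equiv> gmm_beta \<mu> \<tau> \<psi> \<alpha>" and "\<gamma> \<equiv> gmm_gamma \<mu> \<tau> \<psi> \<alpha>"
  assumes dyn: "\<And>\<omega>. \<omega> \<in> space M \<Longrightarrow> noisy_gmm f \<alpha> \<beta> \<gamma> x0 xm1 (\<lambda>k. w k \<omega>) (\<lambda>k. x k \<omega>)"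
    and noise: "gaussian_gradient_noise M \<sigma> w x"
    and \<theta>: "0 < \<theta>" "\<theta> \<le> \<Theta>" "\<Theta> * c < 2"
    and r: "(1 - sqrt (\<tau> * \<alpha> * \<mu>)) * 2 / (2 - \<Theta> * c) \<le> r" "0 < r" "r < 1"
  shows "(\<integral>\<^sup>+\<omega>. ennreal (exp (\<theta> / (2 * \<sigma>\<^sup>2) * lyap f xs \<mu> \<tau> \<alpha> (x (int k) \<omega>) (x (int k - 1) \<omega>))) \<partial>M)
      \<le> ennreal (exp (\<theta> * (r ^ k / (2 * \<sigma>\<^sup>2) * lyap f xs \<mu> \<tau> \<alpha> x0 xm1
            + real CARD('n) * c / (2 * (2 - \<Theta> * c)) * (\<Sum>i<k. r ^ i))))"
  using \<theta>(1,2)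
proof (induction k arbitrary: \<theta>)
  case 0
  have "(\<integral>\<^sup>+\<omega>. ennreal (exp (\<theta> / (2 * \<sigma>\<^sup>2) * lyap f xs \<mu> \<tau> \<alpha> (x (int 0) \<omega>) (x (int 0 - 1) \<omega>))) \<partial>M)
      = (\<integral>\<^sup>+\<omega>. ennreal (exp (\<theta> / (2 * \<sigma>\<^sup>2) * lyap f xs \<mu> \<tau> \<alpha> x0 xm1)) \<partial>M)"
    using dyn by (intro nn_integral_cong) (simp add: noisy_gmm_def)
  then show ?case by (simp add: emeasure_space_1)
next
  case (Suc k)
  let ?X = "\<lambda>\<omega>. (x (int k) \<omega>, x (int k - 1) \<omega>)"
  let ?K = "real CARD('n) * c / (2 * (2 - \<Theta> * c))"
  define G where "G = (\<lambda>(p, u). ennreal (exp (\<theta> / (2 * \<sigma>\<^sup>2)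
      * lyap f xs \<mu> \<tau> \<alpha> (gmm_step f \<alpha> \<beta> \<gamma> (fst p) (snd p) - \<alpha> *\<^sub>R u) (fst p))))"
  have w: "distributed M lborel (w (Suc k)) (\<lambda>u. ennreal (isotropic_normal_density \<sigma> u))"
    and ind: "indep_set {w (Suc k) -` A \<inter> space M | A. A \<in> sets borel} (history_sets M x k)"
    using noise unfolding gaussian_gradient_noise_def by auto
  have XH: "?X -` A \<inter> space M \<in> history_sets M x k" if "A \<in> sets borel" for A
    using that dyn by (intro state_in_history[where ?xm1.0 = xm1]) (auto simp: noisy_gmm_def)
  have norm1: "(\<integral>\<^sup>+u. ennreal (isotropic_normal_density \<sigma> (u :: real ^ 'n)) \<partial>lborel) = 1"
    using distributed_emeasure[OF w, of UNIV] emeasure_space_1 by simp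
  have [measurable]: "f \<in> borel_measurable borel"
    using L_smooth_continuous(1)[OF f(2)] by (rule borel_measurable_continuous_onI)
  have [measurable]: "(\<lambda>p. gmm_step f \<alpha> \<beta> \<gamma> (fst p) (snd p)) \<in> borel_measurable (borel \<Otimes>\<^sub>M borel)"
    using gmm_step_measurable[OF f(2)] unfolding borel_prod .
  have G: "G \<in> borel_measurable (borel \<Otimes>\<^sub>M borel)"
    unfolding G_def lyap_def case_prod_beta borel_prod[symmetric] by measurable
  have "(\<integral>\<^sup>+\<omega>. ennreal (exp (\<theta> / (2 * \<sigma>\<^sup>2) * lyap f xs \<mu> \<tau> \<alpha> (x (int (Suc k)) \<omega>) (x (int (Suc k) - 1) \<omega>))) \<partial>M)
      = (\<integral>\<^sup>+\<omega>. G (?X \<omega>, w (Suc k) \<omega>) \<partial>M)"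
    unfolding G_def using noisy_gmm_Suc[OF dyn]
    by (intro nn_integral_cong) (simp del: of_nat_Suc, simp)
  also have "\<dots> = (\<integral>\<^sup>+\<omega>. (\<integral>\<^sup>+u. ennreal (isotropic_normal_density \<sigma> u) * G (?X \<omega>, u) \<partial>lborel) \<partial>M)"
    by (rule nn_integral_indep_density[OF ind XH w G])
  also have "\<dots> \<le> (\<integral>\<^sup>+\<omega>. ennreal (exp (\<theta> * ?K)) * ennreal (exp (\<theta> * r / (2 * \<sigma>\<^sup>2)
        * lyap f xs \<mu> \<tau> \<alpha> (x (int k) \<omega>) (x (int k - 1) \<omega>))) \<partial>M)"
    using gaussian_lyap_step[OF A f min \<sigma> norm1 Suc.prems \<theta>(3)[unfolded c_def] r(1)[unfolded c_def]]
    by (intro nn_integral_mono) (simp add: G_def c_def \<beta>_def \<gamma>_def ennreal_mult')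
  also have "\<dots> = ennreal (exp (\<theta> * ?K)) * (\<integral>\<^sup>+\<omega>. ennreal (exp (\<theta> * r / (2 * \<sigma>\<^sup>2)
        * lyap f xs \<mu> \<tau> \<alpha> (x (int k) \<omega>) (x (int k - 1) \<omega>))) \<partial>M)"
  proof (rule nn_integral_cmult)
    have [measurable]: "random_variable borel ?X"
      using XH indep_setD_ev2[OF ind] by (intro measurableI) auto
    have "(\<lambda>p. ennreal (exp (\<theta> * r / (2 * \<sigma>\<^sup>2) * lyap f xs \<mu> \<tau> \<alpha> (fst p) (snd p)))) \<in> borel_measurable borel"
      unfolding lyap_def borel_prod[symmetric] by measurable
    from measurable_compose[OF \<open>random_variable borel ?X\<close> this]
    show "(\<lambda>\<omega>. ennreal (exp (\<theta> * r / (2 * \<sigma>\<^sup>2)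
        * lyap f xs \<mu> \<tau> \<alpha> (x (int k) \<omega>) (x (int k - 1) \<omega>)))) \<in> borel_measurable M" by simp
  qed
  also have "\<dots> \<le> ennreal (exp (\<theta> * ?K)) * ennreal (exp (\<theta> * r * (r ^ k / (2 * \<sigma>\<^sup>2) * lyap f xs \<mu> \<tau> \<alpha> x0 xm1
            + ?K * (\<Sum>i<k. r ^ i))))"
  proof (rule mult_left_mono)
    have "\<theta> * r \<le> \<theta> * 1" using Suc.prems r by (intro mult_left_mono) auto
    then have "\<theta> * r \<le> \<Theta>" using Suc.prems by linarith
    then show "(\<integral>\<^sup>+\<omega>. ennreal (exp (\<theta> * r / (2 * \<sigma>\<^sup>2)
        * lyap f xs \<mu> \<tau> \<alpha> (x (int k) \<omega>) (x (int k - 1) \<omega>))) \<partial>M)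
      \<le> ennreal (exp (\<theta> * r * (r ^ k / (2 * \<sigma>\<^sup>2) * lyap f xs \<mu> \<tau> \<alpha> x0 xm1 + ?K * (\<Sum>i<k. r ^ i))))"
      using Suc.prems r by (intro Suc.IH) auto
  qed simp
  also have "\<dots> = ennreal (exp (\<theta> * (r ^ Suc k / (2 * \<sigma>\<^sup>2) * lyap f xs \<mu> \<tau> \<alpha> x0 xm1
            + ?K * (\<Sum>i<Suc k. r ^ i))))"
  proof -
    have sum: "(\<Sum>i<Suc k. r ^ i) = 1 + r * (\<Sum>i<k. r ^ i)"
      by (subst sum.lessThan_Suc_shift) (simp add: sum_distrib_left)
    have pow: "r ^ Suc k / (2 * \<sigma>\<^sup>2) * v = r * (r ^ k / (2 * \<sigma>\<^sup>2) * v)" for v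
      by simp
    have "\<theta> * K + \<theta> * r * (V + K * S) = \<theta> * (r * V + K * (1 + r * S))" for K V S
      by (simp add: algebra_simps)
    then show ?thesis
      by (simp only: ennreal_mult'[symmetric] exp_ge_zero exp_add[symmetric] sum pow)
  qed
  finally show ?case .
qed

text \<open>Markov's inequality for \<open>exp (s * V)\<close>, where \<open>V\<close> dominates the gap in \<open>f\<close>. The inequality is strict
because a partial sum of the geometric series is strictly below its limit.\<close>
lemma (in prob_space) gmm_tail:
  fixes f :: "real ^ 'n \<Rightarrow> real" and w :: "nat \<Rightarrow> 'a \<Rightarrow> real ^ 'n" and x :: "int \<Rightarrow> 'a \<Rightarrow> real ^ 'n"
  assumes A: "admissible L \<mu> \<tau> \<psi> \<alpha>" and f: "strongly_convex \<mu> f" "L_smooth L f"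
    and min: "\<And>u. f xs \<le> f u" and \<sigma>: "0 < \<sigma>"
  defines "c \<equiv> \<alpha> * (\<tau> + \<alpha> * L)" and "\<beta> \<equiv> gmm_beta \<mu> \<tau> \<psi> \<alpha>" and "\<gamma> \<equiv> gmm_gamma \<mu> \<tau> \<psi> \<alpha>"
  assumes dyn: "\<And>\<omega>. \<omega> \<in> space M \<Longrightarrow> noisy_gmm f \<alpha> \<beta> \<gamma> x0 xm1 (\<lambda>k. w k \<omega>) (\<lambda>k. x k \<omega>)"
    and noise: "gaussian_gradient_noise M \<sigma> w x"
    and \<theta>: "0 < \<theta>" "\<theta> * c < 2"
    and r: "(1 - sqrt (\<tau> * \<alpha> * \<mu>)) * 2 / (2 - \<theta> * c) \<le> r" "0 < r" "r < 1"
  shows "prob {\<omega> \<in> space M. f (x (int k) \<omega>) - f xs \<ge> t}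
      < exp (\<theta> / (2 * \<sigma>\<^sup>2) * (r ^ k * 2 * lyap f xs \<mu> \<tau> \<alpha> x0 xm1 - t)
            + \<theta> * real CARD('n) * c / (2 * (1 - r) * (2 - \<theta> * c)))"
proof -
  define s K V0 where "s = \<theta> / (2 * \<sigma>\<^sup>2)" and "K = real CARD('n) * c / (2 * (2 - \<theta> * c))"
    and "V0 = lyap f xs \<mu> \<tau> \<alpha> x0 xm1"
  let ?V = "\<lambda>\<omega>. lyap f xs \<mu> \<tau> \<alpha> (x (int k) \<omega>) (x (int k - 1) \<omega>)"
  let ?E = "{\<omega> \<in> space M. f (x (int k) \<omega>) - f xs \<ge> t}"
  have s: "0 < s" using \<theta> \<sigma> by (simp add: s_def)
  have c: "0 < c" using A by (simp add: c_def admissible_def add_pos_pos)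
  have K: "0 < K" using c \<theta> by (simp add: K_def)
  have V0: "0 \<le> V0" unfolding V0_def by (rule lyap_nonneg) (rule min)
  (* A non-measurable event would have measure 0 by convention, so both cases are covered. *)
  have "ennreal (prob ?E) * ennreal (exp (s * t)) \<le> (\<integral>\<^sup>+\<omega>. ennreal (exp (s * ?V \<omega>)) \<partial>M)"
  proof (cases "?E \<in> events")
    case True
    have "ennreal (prob ?E) * ennreal (exp (s * t)) = (\<integral>\<^sup>+\<omega>. ennreal (exp (s * t)) * indicator ?E \<omega> \<partial>M)"
      using True by (subst nn_integral_cmult_indicator) (auto simp: emeasure_eq_measure mult.commute)
    also have "\<dots> \<le> (\<integral>\<^sup>+\<omega>. ennreal (exp (s * ?V \<omega>)) \<partial>M)"
    proof (rule nn_integral_mono)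
      fix \<omega>
      have "f (x (int k) \<omega>) - f xs \<le> ?V \<omega>" by (simp add: lyap_def)
      then have "t \<le> ?V \<omega>" if "\<omega> \<in> ?E" using that by simp
      then show "ennreal (exp (s * t)) * indicator ?E \<omega> \<le> ennreal (exp (s * ?V \<omega>))"
        using s by (auto simp: indicator_def ennreal_leI)
    qed
    finally show ?thesis .
  qed (simp add: measure_notin_sets)
  also have "\<dots> \<le> ennreal (exp (\<theta> * (r ^ k / (2 * \<sigma>\<^sup>2) * V0 + K * (\<Sum>i<k. r ^ i))))"
    using gmm_exp_moment[OF A f min \<sigma> dyn[unfolded \<beta>_def \<gamma>_def] noise \<theta>(1) order_refl
        \<theta>(2)[unfolded c_def] r(1)[unfolded c_def] r(2,3), of k]
    by (simp add: s_def K_def V0_def c_def)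
  finally have "prob ?E * exp (s * t) \<le> exp (\<theta> * (r ^ k / (2 * \<sigma>\<^sup>2) * V0 + K * (\<Sum>i<k. r ^ i)))"
    by (simp add: ennreal_mult'[symmetric])
  also have "\<dots> < exp (s * (r ^ k * 2 * V0) + \<theta> * K / (1 - r))"
  proof -
    have "(\<Sum>i<k. r ^ i) = (1 - r ^ k) / (1 - r)" using r by (simp add: sum_gp_strict)
    also have "\<dots> < 1 / (1 - r)" using r by (intro divide_strict_right_mono) auto
    finally have "\<theta> * K * (\<Sum>i<k. r ^ i) < \<theta> * K * (1 / (1 - r))"
      using \<theta> K by (intro mult_strict_left_mono) auto
    moreover have "s * (r ^ k * V0) \<le> s * (r ^ k * 2 * V0)"
      using s r V0 by (intro mult_left_mono) auto
    ultimately show ?thesis by (simp add: s_def distrib_left mult.assoc)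
  qed
  finally have "prob ?E * exp (s * t) < exp (s * (r ^ k * 2 * V0) + \<theta> * K / (1 - r))" .
  then have "prob ?E < exp (s * (r ^ k * 2 * V0) + \<theta> * K / (1 - r)) / exp (s * t)"
    by (simp add: less_divide_eq)
  also have "\<dots> = exp (s * (r ^ k * 2 * V0 - t) + \<theta> * K / (1 - r))"
    by (simp add: exp_diff[symmetric] right_diff_distrib)
  also have "\<theta> * K / (1 - r) = \<theta> * real CARD('n) * c / (2 * (1 - r) * (2 - \<theta> * c))"
    by (simp only: K_def times_divide_eq_right divide_divide_eq_left mult_ac)
  finally show ?thesis unfolding s_def V0_def .
qed

text \<open>With \<open>u = \<theta> * c / 2\<close>, the level for which the tail bound equals \<open>exp (- ell)\<close> is
\<open>\<sigma>\<^sup>2 * c / 2 * (D / (1 - u) + 2 * ell / u)\<close>. Over \<open>(0, 1)\<close> its minimum is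
\<open>\<sigma>\<^sup>2 * c / 2 * (sqrt D + sqrt (2 * ell))\<^sup>2\<close>, attained at
\<open>u = sqrt (2 * ell) / (sqrt D + sqrt (2 * ell))\<close>. The case distinction tells whether this point
lies below the cap \<open>\<Theta> * c / 2\<close>; if it does not, the cap itself is used.\<close>
lemma quantile_exponent:
  fixes D c ell \<Theta> \<sigma> :: real
  assumes pos: "0 < D" "0 < c" "0 < ell" "0 < \<Theta>" "\<Theta> * c < 2" "0 < \<sigma>"
  defines "E \<equiv> if ell \<le> D / 2 * (\<Theta> * c / (2 - \<Theta> * c))\<^sup>2
         then \<sigma>\<^sup>2 * c / 2 * (sqrt D + sqrt (2 * ell))\<^sup>2
         else \<sigma>\<^sup>2 * D * c / (2 - \<Theta> * c) + 2 * \<sigma>\<^sup>2 / \<Theta> * ell"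
  obtains \<theta> where "0 < \<theta>" "\<theta> \<le> \<Theta>" "\<theta> * D * c / (2 * (2 - \<theta> * c)) - \<theta> / (2 * \<sigma>\<^sup>2) * E = - ell"
proof (cases "ell \<le> D / 2 * (\<Theta> * c / (2 - \<Theta> * c))\<^sup>2")
  case True
  define p m where "p = sqrt D" and "m = sqrt (2 * ell)"
  have pm: "0 < p" "0 < m" "p\<^sup>2 = D" "m\<^sup>2 = 2 * ell" using pos by (auto simp: p_def m_def)
  define u where "u = m / (p + m)"
  have u: "0 < u" "u * (p + m) = m" "(1 - u) * (p + m) = p" using pm by (auto simp: u_def field_simps)
  define \<theta> where "\<theta> = 2 * u / c"
  have \<theta>c: "\<theta> * c = 2 * u" using pos by (simp add: \<theta>_def)
  define U where "U = \<Theta> * c / 2"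
  have U: "0 < U" "U < 1" using pos by (auto simp: U_def)
  have "\<Theta> * c / (2 - \<Theta> * c) = U / (1 - U)" using pos by (simp add: U_def field_simps)
  then have "m\<^sup>2 \<le> (p * (U / (1 - U)))\<^sup>2" 
    using True by (simp only: power_mult_distrib pm)
  then have "m \<le> p * (U / (1 - U))" by (rule power2_le_imp_le) (use pm(1) U in simp)
  then have "m \<le> U * (p + m)" using U by (simp add: field_simps)
  then have "u \<le> U" using pm(1,2) by (simp add: u_def divide_le_eq)
  then have le: "\<theta> \<le> \<Theta>" using pos by (simp add: \<theta>_def U_def divide_le_eq)
  have "1 - u = p / (p + m)" using pm(1,2) by (simp add: u_def field_simps)
  moreover have "\<theta> * D * c = D * (2 * u)" unfolding \<theta>c[symmetric] by simp
  moreover have "2 * (2 - \<theta> * c) = 4 * (1 - u)" unfolding \<theta>c by simp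
  ultimately have "\<theta> * D * c / (2 * (2 - \<theta> * c)) = D * (2 * u) / (4 * (p / (p + m)))"
    by (simp only:)
  also have "\<dots> = m * p / 2"
  proof -
    have "p\<^sup>2 * (2 * (m / N)) / (4 * (p / N)) = m * p / 2" if "0 < N" for N
      using that pm(1) by (simp add: power2_eq_square)
    then show ?thesis unfolding u_def pm(3)[symmetric] using pm(1,2) by simp
  qed
  finally have first: "\<theta> * D * c / (2 * (2 - \<theta> * c)) = m * p / 2" .
  have "\<theta> / (2 * \<sigma>\<^sup>2) * E = \<theta> * c / 4 * (p + m)\<^sup>2"
    using True pos by (simp add: E_def p_def m_def)
  also have "\<dots> = m * (p + m) / 2" using u(2) unfolding \<theta>c by (simp add: power2_eq_square)
  finally have "\<theta> * D * c / (2 * (2 - \<theta> * c)) - \<theta> / (2 * \<sigma>\<^sup>2) * E = - ell"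
    using pm(4) unfolding first by (simp add: power2_eq_square algebra_simps)
  moreover have "0 < \<theta>" using u pos by (simp add: \<theta>_def)
  ultimately show ?thesis using le that by blast
next
  case False
  have "\<Theta> / (2 * \<sigma>\<^sup>2) * E = \<Theta> * D * c / (2 * (2 - \<Theta> * c)) + ell"
  proof -
    have "E = \<sigma>\<^sup>2 * (D * c / (2 - \<Theta> * c)) + \<sigma>\<^sup>2 * (2 * ell / \<Theta>)" using False by (simp add: E_def mult_ac)
    then show ?thesis using pos by (simp add: distrib_left)
  qed
  then show ?thesis using that[of \<Theta>] pos by simp
qed

theorem corollary2:
  fixes f :: "real ^ 'n \<Rightarrow> real"
    and M :: "'a measure"
    and w :: "nat \<Rightarrow> 'a \<Rightarrow> real ^ 'n"
    and x :: "int \<Rightarrow> 'a \<Rightarrow> real ^ 'n"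
    and xs x0 xm1 :: "real ^ 'n"
    and L \<mu> \<sigma> \<tau> \<psi> \<alpha> :: real
  defines "\<beta> \<equiv> gmm_beta \<mu> \<tau> \<psi> \<alpha>"
    and "\<gamma> \<equiv> gmm_gamma \<mu> \<tau> \<psi> \<alpha>"
    and "d \<equiv> CARD('n)"
    and "R \<equiv> rate_R L \<mu> \<tau> \<psi> \<alpha>"
    and "\<theta>u \<equiv> theta_u L \<mu> \<tau> \<psi> \<alpha>"
    and "V0 \<equiv> lyapunov f xs (P_mat \<mu> \<tau> \<alpha>) x0 xm1"
  assumes "0 < \<mu>" and "\<mu> < L"
    and "strongly_convex \<mu> f" and "L_smooth L f"
    and "\<And>u. f xs \<le> f u"
    and "(\<tau>, \<psi>) \<in> S_zero \<union> S_c L \<mu>" and "gmm_alpha L \<mu> \<tau> \<psi> \<alpha>"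
    and "prob_space M" and "0 < \<sigma>"
    and "\<And>\<omega>. \<omega> \<in> space M \<Longrightarrow> noisy_gmm f \<alpha> \<beta> \<gamma> x0 xm1 (\<lambda>k. w k \<omega>) (\<lambda>k. x k \<omega>)"
    and "gaussian_gradient_noise M \<sigma> w x"
  shows "(\<forall>\<theta> t. \<forall>k::nat. 0 < \<theta> \<and> \<theta> < \<theta>u \<and> 0 < t \<longrightarrow>
            measure M {\<omega> \<in> space M. f (x (int k) \<omega>) - f xs \<ge> t}
            < exp (\<theta> / (2 * \<sigma>\<^sup>2) * (R \<theta> ^ k * 2 * V0 - t)
                   + \<theta> * real d * \<alpha> * (\<tau> + \<alpha> * L)
                     / (2 * (1 - R \<theta>) * (2 - \<theta> * \<alpha> * (\<tau> + \<alpha> * L)))))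
       \<and> (\<forall>\<zeta> \<phi>. \<forall>k::nat. 0 < \<zeta> \<and> \<zeta> < 1 \<and> 0 < \<phi> \<and> \<phi> < 1 \<longrightarrow>
            measure M {\<omega> \<in> space M.
               f (x (int k) \<omega>) - f xs
               \<ge> E_bar L \<mu> \<sigma> d \<tau> \<psi> \<alpha> \<phi> \<zeta> + R (\<phi> * \<theta>u) ^ k * 2 * V0} \<le> \<zeta>)"
proof -
  interpret prob_space M by fact
  note gmm = assms(7-17)
  have A: "admissible L \<mu> \<tau> \<psi> \<alpha>"
  proof (cases "(\<tau>, \<psi>) \<in> S_c L \<mu>")
    case True
    then show ?thesis using gmm(1,2,7) by (intro admissible_Sc) (auto simp: gmm_alpha_def)
  next
    case False
    then have "\<tau> = 1" "\<psi> = 1" "0 < \<alpha>" "\<alpha> \<le> 1 / L"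
      using gmm(6,7) by (auto simp: S_zero_def gmm_alpha_def)
    then show ?thesis using gmm(1,2) admissible_S_zero by simp
  qed
  define c where "c = \<alpha> * (\<tau> + \<alpha> * L)"
  have c: "0 < c" using A by (simp add: c_def admissible_def add_pos_pos)
  have V0: "V0 = lyap f xs \<mu> \<tau> \<alpha> x0 xm1" unfolding V0_def by (rule lyapunov_eq_lyap)
  note bounds = rate_R_bounds[OF A, folded c_def, folded \<theta>u_def R_def]
  have tail: "prob {\<omega> \<in> space M. f (x (int k) \<omega>) - f xs \<ge> t}
      < exp (\<theta> / (2 * \<sigma>\<^sup>2) * (r ^ k * 2 * V0 - t)
            + \<theta> * real d * c / (2 * (1 - r) * (2 - \<theta> * c)))"
    if "0 < \<theta>" "\<theta> * c < 2" "(1 - sqrt (\<tau> * \<alpha> * \<mu>)) * 2 / (2 - \<theta> * c) \<le> r" "0 < r" "r < 1"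
    for \<theta> r t :: real and k :: nat
    unfolding V0 c_def d_def
    using gmm(10)[unfolded \<beta>_def \<gamma>_def] that[unfolded c_def]
    by (rule gmm_tail[OF A gmm(3,4,5,9) _ gmm(11)])
  show ?thesis
  proof (intro conjI allI impI)
    fix \<theta> t :: real and k :: nat
    assume "0 < \<theta> \<and> \<theta> < \<theta>u \<and> 0 < t"
    then have "0 < \<theta>" "\<theta> < \<theta>u" by auto
    then have "prob {\<omega> \<in> space M. f (x (int k) \<omega>) - f xs \<ge> t}
            < exp (\<theta> / (2 * \<sigma>\<^sup>2) * (R \<theta> ^ k * 2 * V0 - t)
                   + \<theta> * real d * c / (2 * (1 - R \<theta>) * (2 - \<theta> * c)))"
      by (intro tail bounds)
    then show "prob {\<omega> \<in> space M. f (x (int k) \<omega>) - f xs \<ge> t}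
            < exp (\<theta> / (2 * \<sigma>\<^sup>2) * (R \<theta> ^ k * 2 * V0 - t)
                   + \<theta> * real d * \<alpha> * (\<tau> + \<alpha> * L)
                     / (2 * (1 - R \<theta>) * (2 - \<theta> * \<alpha> * (\<tau> + \<alpha> * L))))"
      by (simp add: c_def mult.assoc)
  next
    fix \<zeta> \<phi> :: real and k :: nat
    assume "0 < \<zeta> \<and> \<zeta> < 1 \<and> 0 < \<phi> \<and> \<phi> < 1"
    then have \<zeta>: "0 < \<zeta>" "\<zeta> < 1" and \<phi>: "0 < \<phi>" "\<phi> < 1" by auto
    define \<Theta> r D ell E where "\<Theta> = \<phi> * \<theta>u" and "r = R \<Theta>" and "D = real d / (1 - r)"
      and "ell = ln (1 / \<zeta>)" and "E = E_bar L \<mu> \<sigma> d \<tau> \<psi> \<alpha> \<phi> \<zeta>"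
    have "0 < \<theta>u" unfolding \<theta>u_def by (rule theta_u_pos[OF A])
    then have \<Theta>: "0 < \<Theta>" "\<Theta> < \<theta>u" using \<phi> by (simp_all add: \<Theta>_def)
    note b = bounds[OF \<Theta>, folded r_def]
    have D: "0 < D" using b(4) by (simp add: D_def d_def)
    have ell: "0 < ell" using \<zeta> by (simp add: ell_def)
    have E: "E = (if ell \<le> D / 2 * (\<Theta> * c / (2 - \<Theta> * c))\<^sup>2
         then \<sigma>\<^sup>2 * c / 2 * (sqrt D + sqrt (2 * ell))\<^sup>2
         else \<sigma>\<^sup>2 * D * c / (2 - \<Theta> * c) + 2 * \<sigma>\<^sup>2 / \<Theta> * ell)"
    proof -
      have "real d / (2 * (1 - r)) = D / 2"
        and "\<sigma>\<^sup>2 * real d * c / ((1 - r) * (2 - \<Theta> * c)) = \<sigma>\<^sup>2 * D * c / (2 - \<Theta> * c)"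
        by (simp_all add: D_def mult.commute)
      then show ?thesis
        unfolding E_def E_bar_def Let_def \<theta>u_def[symmetric] \<Theta>_def[symmetric] R_def[symmetric]
          r_def[symmetric] c_def[symmetric] ell_def[symmetric] D_def[symmetric] by (simp only:)
    qed
    obtain \<theta> where \<theta>: "0 < \<theta>" "\<theta> \<le> \<Theta>"
      and opt: "\<theta> * D * c / (2 * (2 - \<theta> * c)) - \<theta> / (2 * \<sigma>\<^sup>2) * E = - ell"
      using quantile_exponent[OF D c ell \<Theta>(1) b(1) gmm(9)] unfolding E by blast
    (* The rate belongs to \<Theta>, the optimal risk parameter may be smaller; the required rate is
       monotone in the risk parameter. *)
    have \<theta>c: "\<theta> * c \<le> \<Theta> * c" using \<theta> c by simp
    have "0 \<le> (1 - sqrt (\<tau> * \<alpha> * \<mu>)) * 2" using admissible_bounds[OF A] by simp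
    then have "(1 - sqrt (\<tau> * \<alpha> * \<mu>)) * 2 / (2 - \<theta> * c) \<le> (1 - sqrt (\<tau> * \<alpha> * \<mu>)) * 2 / (2 - \<Theta> * c)"
      using \<theta>c b(1) by (intro divide_left_mono mult_pos_pos) auto
    then have rate: "(1 - sqrt (\<tau> * \<alpha> * \<mu>)) * 2 / (2 - \<theta> * c) \<le> r" using b(2) by linarith
    have "\<theta> * c < 2" using \<theta>c b(1) by linarith
    from tail[OF \<theta>(1) this rate b(3,4), of "E + r ^ k * 2 * V0" k]
    have "prob {\<omega> \<in> space M. f (x (int k) \<omega>) - f xs \<ge> E + r ^ k * 2 * V0}
        < exp (\<theta> / (2 * \<sigma>\<^sup>2) * (r ^ k * 2 * V0 - (E + r ^ k * 2 * V0))
            + \<theta> * real d * c / (2 * (1 - r) * (2 - \<theta> * c)))" .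
    also have "\<theta> / (2 * \<sigma>\<^sup>2) * (r ^ k * 2 * V0 - (E + r ^ k * 2 * V0))
            + \<theta> * real d * c / (2 * (1 - r) * (2 - \<theta> * c)) = - ell"
    proof -
      have "\<theta> * real d * c / (2 * (1 - r) * (2 - \<theta> * c)) = \<theta> * D * c / (2 * (2 - \<theta> * c))"
        by (simp only: D_def times_divide_eq_right times_divide_eq_left divide_divide_eq_left mult_ac)
      then show ?thesis using opt by simp
    qed
    also have "exp (- ell) = \<zeta>" using \<zeta> by (simp add: ell_def ln_div)
    finally show "prob {\<omega> \<in> space M. f (x (int k) \<omega>) - f xs
               \<ge> E_bar L \<mu> \<sigma> d \<tau> \<psi> \<alpha> \<phi> \<zeta> + R (\<phi> * \<theta>u) ^ k * 2 * V0} \<le> \<zeta>"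
      by (simp add: E_def r_def \<Theta>_def)
  qed
qed

end
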